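(* Assume $u_4<u_3<u_2<u_1$ are real with $u_1+u_2+u_3+u_4=0$, $u_1+u_2\ne0$, $u_1+u_3\ne0$, $u_2+u_3\ne0$. Let $$u(x)=u_4+\frac{(u_1-u_4)(u_2-u_4)}{(u_2-u_4)+(u_1-u_2)\,\mathrm{sn}^2(\nu x;\kappa)},\qquad 4\nu^2=(u_1-u_3)(u_2-u_4),\quad 4\nu^2\kappa^2=(u_1-u_2)(u_3-u_4),$$ with $\nu>0$, $\kappa\in(0,1)$, and let $\lambda_1=\frac12(u_1+u_2)$, $\lambda_2=\frac12(u_1+u_3)$, $\lambda_3=\frac12(u_2+u_3)$. (1) For each $j\in\{1,2,3\}$, the one-fold Darboux transformation with the periodic eigenfunction for $\lambda_j$ transforms the periodic wave $u$ to the periodic wave of the same period obtained from $u$ after the symmetry transformation $(Sj)$ and the reflection $u\mapsto-u$. (2) The two-fold Darboux transformation with the periodic eigenfunctions for any two of the eigenvalues, $(\lambda_i,\lambda_j)$ with $i\ne j$, transforms $u$ to the periodic wave of the same period obtained from $u$ after the complementary third symmetry transformation $(Sk)$, $\{i,j,k\}=\{1,2,3\}$. (3) The three-fold Darboux transformation with the periodic eigenfunctions for all three eigenvalues maps $u$ to itself reflected with $u\mapsto-u$.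
   Context: $\mathrm{sn}(\cdot;\kappa)$ is the Jacobian elliptic function with modulus $\kappa$. The symmetry transformations are exchanges of parameters in the formula for $u$ (which leave $\nu,\kappa$ unchanged): $(S1)$ $u_1\leftrightarrow u_2$, $u_3\leftrightarrow u_4$; $(S2)$ $u_1\leftrightarrow u_3$, $u_2\leftrightarrow u_4$; $(S3)$ $u_1\leftrightarrow u_4$, $u_2\leftrightarrow u_3$. Let $c=-(u_1u_2+u_1u_3+u_1u_4+u_2u_3+u_2u_4+u_3u_4)$ and $2e=u_1u_2u_3+u_1u_2u_4+u_1u_3u_4+u_2u_3u_4$. Then $u(x-ct)$ solves the modified Korteweg--de Vries equation $u_t+6u^2u_x+u_{xxx}=0$. The periodic eigenfunction for $\lambda_j$ is the solution $\varphi=(p_j,q_j)^t$ (unique up to scalar multiplication) of $\varphi_x=\begin{pmatrix}\lambda&u\\-u&-\lambda\end{pmatrix}\varphi$ with $\lambda=\lambda_j$ whose squared components are, up to a common nonzero constant factor $m_j$, $$p_j^2+q_j^2=m_j(e+4\lambda_j^2u),\quad p_j^2-q_j^2=2m_j\lambda_ju_x,\quad 2p_jq_j=m_j\lambda_j(c-4\lambda_j^2-2u^2).$$ The Darboux transformations of $u$ with solutions $(p_j,q_j)$ for $\lambda_j$ are: one-fold (with $(\lambda_1,p_1,q_1)$ standing for the chosen data) $$\tilde u=u+\frac{4\lambda_1p_1q_1}{p_1^2+q_1^2};$$ two-fold (with indices $1,2$ standing for the chosen pair) $$\tilde u=u+\frac{4(\lambda_1^2-\lambda_2^2)[\lambda_1p_1q_1(p_2^2+q_2^2)-\lambda_2p_2q_2(p_1^2+q_1^2)]}{(\lambda_1^2+\lambda_2^2)(p_1^2+q_1^2)(p_2^2+q_2^2)-2\lambda_1\lambda_2[4p_1q_1p_2q_2+(p_1^2-q_1^2)(p_2^2-q_2^2)]};$$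 three-fold $\tilde u=u+4N/D$ with $$\begin{aligned}N=&(\lambda_3^2-\lambda_1^2)(\lambda_3^2-\lambda_2^2)\lambda_3p_3q_3[(\lambda_1^2+\lambda_2^2)(p_1^2+q_1^2)(p_2^2+q_2^2)-2\lambda_1\lambda_2(p_1^2-q_1^2)(p_2^2-q_2^2)]\\&+(\lambda_2^2-\lambda_1^2)(\lambda_2^2-\lambda_3^2)\lambda_2p_2q_2[(\lambda_1^2+\lambda_3^2)(p_1^2+q_1^2)(p_3^2+q_3^2)-2\lambda_1\lambda_3(p_1^2-q_1^2)(p_3^2-q_3^2)]\\&+(\lambda_1^2-\lambda_2^2)(\lambda_1^2-\lambda_3^2)\lambda_1p_1q_1[(\lambda_2^2+\lambda_3^2)(p_2^2+q_2^2)(p_3^2+q_3^2)-2\lambda_2\lambda_3(p_2^2-q_2^2)(p_3^2-q_3^2)]\\&-8(\lambda_1^4+\lambda_2^4+\lambda_3^4-\lambda_1^2\lambda_2^2-\lambda_1^2\lambda_3^2-\lambda_2^2\lambda_3^2)\lambda_1\lambda_2\lambda_3p_1p_2p_3q_1q_2q_3,\end{aligned}$$ $$\begin{aligned}D=&(\lambda_1+\lambda_2)^2(\lambda_1+\lambda_3)^2(\lambda_2-\lambda_3)^2(p_1^2q_2^2q_3^2+q_1^2p_2^2p_3^2)+(\lambda_1+\lambda_2)^2(\lambda_2+\lambda_3)^2(\lambda_1-\lambda_3)^2(p_2^2q_1^2q_3^2+q_2^2p_1^2p_3^2)\\&+(\lambda_1+\lambda_3)^2(\lambda_2+\lambda_3)^2(\lambda_1-\lambda_2)^2(p_3^2q_1^2q_2^2+q_3^2p_1^2p_2^2)+(\lambda_1-\lambda_2)^2(\lambda_1-\lambda_3)^2(\lambda_2-\lambda_3)^2(p_1^2p_2^2p_3^2+q_1^2q_2^2q_3^2)\\&-8(\lambda_3^2-\lambda_1^2)(\lambda_3^2-\lambda_2^2)\lambda_1\lambda_2p_1p_2q_1q_2(p_3^2+q_3^2)-8(\lambda_2^2-\lambda_1^2)(\lambda_2^2-\lambda_3^2)\lambda_1\lambda_3p_1p_3q_1q_3(p_2^2+q_2^2)\\&-8(\lambda_1^2-\lambda_2^2)(\lambda_1^2-\lambda_3^2)\lambda_2\lambda_3p_2p_3q_2q_3(p_1^2+q_1^2).\end{aligned}$$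 *)

theory Defs
  imports "HOL-Analysis.Analysis"
begin

definition elliptic_F :: "real \<Rightarrow> real \<Rightarrow> real" where
  "elliptic_F k phi = (LBINT t = ereal 0..ereal phi. 1 / sqrt (1 - k\<^sup>2 * (sin t)\<^sup>2))"

(* For 0 < k < 1 the map elliptic_F k is an increasing bijection of the real line,
   so the description below is proper. Here k is the modulus, not the parameter k^2. *)
definition jacobi_am :: "real \<Rightarrow> real \<Rightarrow> real" where
  "jacobi_am k x = (THE phi. elliptic_F k phi = x)"

definition jacobi_sn :: "real \<Rightarrow> real \<Rightarrow> real" where
  "jacobi_sn k x = sin (jacobi_am k x)"

(* The third parameter enters the wave only through nu and k, which are kept as
   separate arguments because the parameter exchanges below leave them unchanged. *)
definition periodic_wave ::
    "real \<Rightarrow> real \<Rightarrow> real \<times> real \<times> real \<times> real \<Rightarrow> real \<Rightarrow> real" where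
  "periodic_wave nu k = (\<lambda>(u1, u2, u3, u4) x.
     u4 + (u1 - u4) * (u2 - u4) / ((u2 - u4) + (u1 - u2) * (jacobi_sn k (nu * x))\<^sup>2))"

(* Only the indices 1, 2, 3 are meaningful. *)
definition symmetry ::
    "nat \<Rightarrow> real \<times> real \<times> real \<times> real \<Rightarrow> real \<times> real \<times> real \<times> real" where
  "symmetry j = (\<lambda>(u1, u2, u3, u4).
     if j = 1 then (u2, u1, u4, u3)
     else if j = 2 then (u3, u4, u1, u2)
     else (u4, u3, u2, u1))"

definition fundamental_period :: "(real \<Rightarrow> 'a) \<Rightarrow> real \<Rightarrow> bool" where
  "fundamental_period f T \<longleftrightarrow>
     0 < T \<and> (\<forall>x. f (x + T) = f x) \<and>
     (\<forall>S. 0 < S \<and> S < T \<longrightarrow> \<not> (\<forall>x. f (x + S) = f x))"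

(* Complex-valued eigenfunctions are allowed, with a complex normalising factor m;
   real eigenfunctions are the special case of real-valued p and q. *)
definition periodic_eigenfunction ::
    "(real \<Rightarrow> real) \<Rightarrow> real \<Rightarrow> real \<Rightarrow> real \<Rightarrow> (real \<Rightarrow> complex) \<Rightarrow> (real \<Rightarrow> complex) \<Rightarrow> bool" where
  "periodic_eigenfunction u c e l p q \<longleftrightarrow>
     (\<forall>x. (p has_vector_derivative (of_real l * p x + of_real (u x) * q x)) (at x)) \<and>
     (\<forall>x. (q has_vector_derivative (- of_real (u x) * p x - of_real l * q x)) (at x)) \<and>
     (\<exists>m. m \<noteq> 0 \<and> (\<forall>x.
        (p x)\<^sup>2 + (q x)\<^sup>2 = m * of_real (e + 4 * l\<^sup>2 * u x) \<and>
        (p x)\<^sup>2 - (q x)\<^sup>2 = 2 * m * of_real (l * deriv u x) \<and>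
        2 * p x * q x = m * of_real (l * (c - 4 * l\<^sup>2 - 2 * (u x)\<^sup>2))))"

(* The denominators are named so that their nonvanishing can be stated: division by
   zero yields zero here. *)
definition onefold_den :: "complex \<Rightarrow> complex \<Rightarrow> complex" where
  "onefold_den p q = p\<^sup>2 + q\<^sup>2"

definition onefold_DT ::
    "real \<Rightarrow> (real \<Rightarrow> complex) \<Rightarrow> (real \<Rightarrow> complex) \<Rightarrow> (real \<Rightarrow> real) \<Rightarrow> real \<Rightarrow> complex" where
  "onefold_DT l p q u x =
     of_real (u x) + 4 * of_real l * p x * q x / onefold_den (p x) (q x)"

definition twofold_num ::
    "complex \<Rightarrow> complex \<Rightarrow> complex \<Rightarrow> complex \<Rightarrow> complex \<Rightarrow> complex \<Rightarrow> complex" where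
  "twofold_num l1 p1 q1 l2 p2 q2 =
     (l1\<^sup>2 - l2\<^sup>2) * (l1 * p1 * q1 * (p2\<^sup>2 + q2\<^sup>2) - l2 * p2 * q2 * (p1\<^sup>2 + q1\<^sup>2))"

definition twofold_den ::
    "complex \<Rightarrow> complex \<Rightarrow> complex \<Rightarrow> complex \<Rightarrow> complex \<Rightarrow> complex \<Rightarrow> complex" where
  "twofold_den l1 p1 q1 l2 p2 q2 =
     (l1\<^sup>2 + l2\<^sup>2) * (p1\<^sup>2 + q1\<^sup>2) * (p2\<^sup>2 + q2\<^sup>2)
     - 2 * l1 * l2 * (4 * p1 * q1 * p2 * q2 + (p1\<^sup>2 - q1\<^sup>2) * (p2\<^sup>2 - q2\<^sup>2))"

definition twofold_DT ::
    "real \<Rightarrow> (real \<Rightarrow> complex) \<Rightarrow> (real \<Rightarrow> complex) \<Rightarrow>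
     real \<Rightarrow> (real \<Rightarrow> complex) \<Rightarrow> (real \<Rightarrow> complex) \<Rightarrow> (real \<Rightarrow> real) \<Rightarrow> real \<Rightarrow> complex" where
  "twofold_DT l1 p1 q1 l2 p2 q2 u x =
     of_real (u x) +
     4 * twofold_num (of_real l1) (p1 x) (q1 x) (of_real l2) (p2 x) (q2 x)
       / twofold_den (of_real l1) (p1 x) (q1 x) (of_real l2) (p2 x) (q2 x)"

definition threefold_num ::
    "complex \<Rightarrow> complex \<Rightarrow> complex \<Rightarrow> complex \<Rightarrow> complex \<Rightarrow> complex \<Rightarrow>
     complex \<Rightarrow> complex \<Rightarrow> complex \<Rightarrow> complex" where
  "threefold_num l1 p1 q1 l2 p2 q2 l3 p3 q3 =
     (l3\<^sup>2 - l1\<^sup>2) * (l3\<^sup>2 - l2\<^sup>2) * l3 * p3 * q3 *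
       ((l1\<^sup>2 + l2\<^sup>2) * (p1\<^sup>2 + q1\<^sup>2) * (p2\<^sup>2 + q2\<^sup>2)
        - 2 * l1 * l2 * (p1\<^sup>2 - q1\<^sup>2) * (p2\<^sup>2 - q2\<^sup>2))
     + (l2\<^sup>2 - l1\<^sup>2) * (l2\<^sup>2 - l3\<^sup>2) * l2 * p2 * q2 *
       ((l1\<^sup>2 + l3\<^sup>2) * (p1\<^sup>2 + q1\<^sup>2) * (p3\<^sup>2 + q3\<^sup>2)
        - 2 * l1 * l3 * (p1\<^sup>2 - q1\<^sup>2) * (p3\<^sup>2 - q3\<^sup>2))
     + (l1\<^sup>2 - l2\<^sup>2) * (l1\<^sup>2 - l3\<^sup>2) * l1 * p1 * q1 *
       ((l2\<^sup>2 + l3\<^sup>2) * (p2\<^sup>2 + q2\<^sup>2) * (p3\<^sup>2 + q3\<^sup>2)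
        - 2 * l2 * l3 * (p2\<^sup>2 - q2\<^sup>2) * (p3\<^sup>2 - q3\<^sup>2))
     - 8 * (l1 ^ 4 + l2 ^ 4 + l3 ^ 4 - l1\<^sup>2 * l2\<^sup>2 - l1\<^sup>2 * l3\<^sup>2 - l2\<^sup>2 * l3\<^sup>2)
       * l1 * l2 * l3 * p1 * p2 * p3 * q1 * q2 * q3"

definition threefold_den ::
    "complex \<Rightarrow> complex \<Rightarrow> complex \<Rightarrow> complex \<Rightarrow> complex \<Rightarrow> complex \<Rightarrow>
     complex \<Rightarrow> complex \<Rightarrow> complex \<Rightarrow> complex" where
  "threefold_den l1 p1 q1 l2 p2 q2 l3 p3 q3 =
     (l1 + l2)\<^sup>2 * (l1 + l3)\<^sup>2 * (l2 - l3)\<^sup>2 * (p1\<^sup>2 * q2\<^sup>2 * q3\<^sup>2 + q1\<^sup>2 * p2\<^sup>2 * p3\<^sup>2)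
     + (l1 + l2)\<^sup>2 * (l2 + l3)\<^sup>2 * (l1 - l3)\<^sup>2 * (p2\<^sup>2 * q1\<^sup>2 * q3\<^sup>2 + q2\<^sup>2 * p1\<^sup>2 * p3\<^sup>2)
     + (l1 + l3)\<^sup>2 * (l2 + l3)\<^sup>2 * (l1 - l2)\<^sup>2 * (p3\<^sup>2 * q1\<^sup>2 * q2\<^sup>2 + q3\<^sup>2 * p1\<^sup>2 * p2\<^sup>2)
     + (l1 - l2)\<^sup>2 * (l1 - l3)\<^sup>2 * (l2 - l3)\<^sup>2 * (p1\<^sup>2 * p2\<^sup>2 * p3\<^sup>2 + q1\<^sup>2 * q2\<^sup>2 * q3\<^sup>2)
     - 8 * (l3\<^sup>2 - l1\<^sup>2) * (l3\<^sup>2 - l2\<^sup>2) * l1 * l2 * p1 * p2 * q1 * q2 * (p3\<^sup>2 + q3\<^sup>2)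
     - 8 * (l2\<^sup>2 - l1\<^sup>2) * (l2\<^sup>2 - l3\<^sup>2) * l1 * l3 * p1 * p3 * q1 * q3 * (p2\<^sup>2 + q2\<^sup>2)
     - 8 * (l1\<^sup>2 - l2\<^sup>2) * (l1\<^sup>2 - l3\<^sup>2) * l2 * l3 * p2 * p3 * q2 * q3 * (p1\<^sup>2 + q1\<^sup>2)"

definition threefold_DT ::
    "real \<Rightarrow> (real \<Rightarrow> complex) \<Rightarrow> (real \<Rightarrow> complex) \<Rightarrow>
     real \<Rightarrow> (real \<Rightarrow> complex) \<Rightarrow> (real \<Rightarrow> complex) \<Rightarrow>
     real \<Rightarrow> (real \<Rightarrow> complex) \<Rightarrow> (real \<Rightarrow> complex) \<Rightarrow> (real \<Rightarrow> real) \<Rightarrow> real \<Rightarrow> complex" where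
  "threefold_DT l1 p1 q1 l2 p2 q2 l3 p3 q3 u x =
     of_real (u x) +
     4 * threefold_num (of_real l1) (p1 x) (q1 x) (of_real l2) (p2 x) (q2 x)
           (of_real l3) (p3 x) (q3 x)
       / threefold_den (of_real l1) (p1 x) (q1 x) (of_real l2) (p2 x) (q2 x)
           (of_real l3) (p3 x) (q3 x)"

end

theory Submission
  imports Defs
begin


text \<open>The three eigenvalues are convenient coordinates. Since the \<open>u1\<close>, ...,
  \<open>u4\<close> sum to zero, \<open>u1 = l1 + l2 - l3\<close>, \<open>u2 = l1 - l2 + l3\<close>,
  \<open>u3 = - l1 + l2 + l3\<close>, \<open>u4 = - l1 - l2 - l3\<close>, while c is twice the sum
  of the squares of the eigenvalues and \<open>e = - 4 * l1 * l2 * l3\<close>. For an eigenvalue l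
  with the other two called l', l'', put a = l u - l' l'' and g = l'^2 + l''^2 - l^2 - u^2. The
  squared eigenfunction then reads p^2 + q^2 = 4 M a, p^2 - q^2 = 2 M u', p q = M g, and these are
  compatible because the first integral u'^2 = -(u - u1)(u - u2)(u - u3)(u - u4) of the wave
  (\<open>periodic_wave_derivs\<close>) is the same as u'^2 = 4 a^2 - g^2.

  The one-fold transformation gives u + l g / a. Its quadratic terms cancel, leaving minus a Moebius
  involution of u that exchanges the four parameters in two pairs. The wave itself is the Moebius
  function of y = sn^2 taking 0, 1, 1/kappa^2 and infinity to \<open>u1\<close>, \<open>u2\<close>,
  \<open>u3\<close> and \<open>u4\<close>; exchanging parameters in pairs keeps the cross-ratio, so
  the exchanged wave is the image of u under that involution
  (\<open>periodic_wave_symmetries\<close>). In the two-fold transformation numerator and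
  denominator share a factor, and what remains is -(u + l'' g'' / a''), minus the one-fold result
  for the third eigenvalue. In the three-fold one the quotient N/D collapses to -u/2. These are
  polynomial identities modulo u'^2 = 4 a^2 - g^2 (the \<open>_reduced\<close> lemmas).

  No denominator vanishes, because u stays in the interval from \<open>u2\<close> to
  \<open>u1\<close>, on which a has no zero. All the waves are injective functions of sn^2 on its
  range, hence share its fundamental period (\<open>fundamental_period_jacobi_sn_sq\<close>).
  Finally \<open>periodic_eigenfunction_exists\<close> integrates the linear system by a quadrature,
  so the claims about eigenfunctions are not vacuous.\<close>

section \<open>The elliptic integral, the amplitude and the period of sn^2\<close>

lemma modulus_radicand_pos:
  assumes "0 < k" "k < (1::real)"
  shows "0 < 1 - k\<^sup>2 * (sin t)\<^sup>2"
proof -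
  have "k\<^sup>2 < 1" using assms by (simp add: power_less_one_iff)
  moreover have "k\<^sup>2 * (sin t)\<^sup>2 \<le> k\<^sup>2 * 1"
    by (intro mult_left_mono) (auto simp: abs_square_le_1)
  ultimately show ?thesis by linarith
qed

lemma DERIV_elliptic_F:
  assumes k: "0 < k" "k < 1"
  shows "DERIV (elliptic_F k) x :> 1 / sqrt (1 - k\<^sup>2 * (sin x)\<^sup>2)"
proof -
  define f where "f t = 1 / sqrt (1 - k\<^sup>2 * (sin t)\<^sup>2)" for t
  \<comment> \<open>The interval from -b to b contains the base point 0 and has x in its interior,
    so the one-sided form of the fundamental theorem yields a full derivative.\<close>
  define b where "b = \<bar>x\<bar> + 1"
  have nz: "1 - k\<^sup>2 * (sin t)\<^sup>2 \<noteq> 0" for t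
    using modulus_radicand_pos[OF k, of t] by simp
  have "continuous_on {-b..b} f"
    unfolding f_def by (intro continuous_intros) (use nz in auto)
  then have "((\<lambda>y. LBINT t = ereal 0..ereal y. f t) has_vector_derivative f x) (at x within {-b..b})"
    by (intro interval_integral_FTC2) (auto simp: b_def)
  then have "((\<lambda>y. LBINT t = ereal 0..ereal y. f t) has_vector_derivative f x) (at x)"
    by (subst (asm) at_within_Icc_at) (auto simp: b_def)
  then show ?thesis
    by (simp add: has_real_derivative_iff_has_vector_derivative f_def elliptic_F_def[abs_def])
qed

lemma elliptic_F_0: "elliptic_F k 0 = 0"
  by (simp add: elliptic_F_def zero_ereal_def[symmetric])

text \<open>The integrand is at least 1. This one inequality gives injectivity, unboundedness in
  both directions and the sign information used for the period.\<close>

lemma elliptic_F_expanding: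
  assumes k: "0 < k" "k < 1" and "x < y"
  shows "y - x \<le> elliptic_F k y - elliptic_F k x"
proof -
  have "x - elliptic_F k x \<ge> y - elliptic_F k y"
  proof (rule DERIV_nonpos_imp_nonincreasing[of x y])
    fix t
    have "sqrt (1 - k\<^sup>2 * (sin t)\<^sup>2) \<le> 1" by simp
    then have "1 - 1 / sqrt (1 - k\<^sup>2 * (sin t)\<^sup>2) \<le> 0"
      using modulus_radicand_pos[OF k, of t] by (simp add: field_simps)
    then show "\<exists>d. DERIV (\<lambda>t. t - elliptic_F k t) t :> d \<and> d \<le> 0"
      using DERIV_diff[OF DERIV_ident DERIV_elliptic_F[OF k]] by blast
  qed (use assms in auto)
  then show ?thesis by simp
qed

lemma continuous_on_elliptic_F:
  assumes "0 < k" "k < 1"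
  shows "continuous_on S (elliptic_F k)"
  using DERIV_elliptic_F[OF assms] by (meson DERIV_continuous_on DERIV_subset subset_UNIV)

lemma bij_elliptic_F:
  assumes k: "0 < k" "k < 1"
  shows "bij (elliptic_F k)"
proof (rule bijI)
  show "inj (elliptic_F k)"
    by (rule linorder_injI) (use elliptic_F_expanding[OF k] in fastforce)
  show "surj (elliptic_F k)"
  proof (unfold surj_def, rule allI)
    fix y :: real
    define b where "b = \<bar>y\<bar> + 1"
    have "0 < b" by (simp add: b_def)
    then have "b \<le> elliptic_F k b" "elliptic_F k (-b) \<le> -b"
      using elliptic_F_expanding[OF k, of 0 b] elliptic_F_expanding[OF k, of "-b" 0]
      by (auto simp: elliptic_F_0)
    then have "\<exists>x\<ge>-b. x \<le> b \<and> elliptic_F k x = y"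
      by (intro IVT' continuous_on_elliptic_F k) (auto simp: b_def)
    then show "\<exists>x. y = elliptic_F k x" by auto
  qed
qed

lemma elliptic_F_jacobi_am:
  assumes "0 < k" "k < 1"
  shows "elliptic_F k (jacobi_am k x) = x"
proof -
  have "\<exists>!phi. elliptic_F k phi = x"
    using bij_elliptic_F[OF assms] by (simp add: bij_iff)
  then show ?thesis unfolding jacobi_am_def by (rule theI')
qed

lemma jacobi_am_elliptic_F:
  assumes "0 < k" "k < 1"
  shows "jacobi_am k (elliptic_F k phi) = phi"
  using elliptic_F_jacobi_am[OF assms] bij_elliptic_F[OF assms]
  by (meson bij_is_inj injD)

text \<open>Inverse function theorem: the derivative of the amplitude is the reciprocal of the
  integrand, that is, the function dn.\<close>

lemma DERIV_jacobi_am: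
  assumes k: "0 < k" "k < 1"
  shows "DERIV (jacobi_am k) x :> sqrt (1 - k\<^sup>2 * (jacobi_sn k x)\<^sup>2)"
proof -
  let ?D = "1 / sqrt (1 - k\<^sup>2 * (sin (jacobi_am k x))\<^sup>2)"
  have "?D \<noteq> 0"
    using modulus_radicand_pos[OF k, of "jacobi_am k x"] by simp
  then have id: "(*) ?D \<circ> (*) (inverse ?D) = id"
    by (simp add: fun_eq_iff)
  have "(jacobi_am k has_derivative (*) (inverse ?D)) (at (elliptic_F k (jacobi_am k x)))"
    by (rule has_derivative_inverse_strong[OF open_UNIV UNIV_I continuous_on_elliptic_F[OF k]
          jacobi_am_elliptic_F[OF k] DERIV_elliptic_F[OF k, unfolded has_field_derivative_def] id])
  then show ?thesis
    using elliptic_F_jacobi_am[OF k] by (simp add: jacobi_sn_def has_field_derivative_def)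
qed

text \<open>The integrand depends on the angle through the squared sine only and so has period pi;
  the increment over one such period is therefore constant.\<close>

lemma elliptic_F_plus_pi:
  assumes k: "0 < k" "k < 1"
  shows "elliptic_F k (phi + pi) = elliptic_F k phi + elliptic_F k pi"
proof -
  have "DERIV (\<lambda>t. elliptic_F k (t + pi) - elliptic_F k t) t :> 0" for t
    using DERIV_diff[OF DERIV_shift[THEN iffD1, OF DERIV_elliptic_F[OF k, of "t + pi"]] DERIV_elliptic_F[OF k, of t]]
    by simp
  then have "elliptic_F k (phi + pi) - elliptic_F k phi = elliptic_F k (0 + pi) - elliptic_F k 0"
    by (intro DERIV_isconst_all) blast
  then show ?thesis by (simp add: elliptic_F_0)
qed

lemma jacobi_am_plus_period:
  assumes "0 < k" "k < 1"
  shows "jacobi_am k (x + elliptic_F k pi) = jacobi_am k x + pi"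
  by (metis assms elliptic_F_jacobi_am elliptic_F_plus_pi jacobi_am_elliptic_F)

text \<open>The number \<open>elliptic_F k pi\<close> is 2K, with K the complete elliptic integral.
  A shorter period S is refuted at the single point 0: there sn vanishes, whereas the amplitude at
  \<open>nu * S\<close> lies strictly between 0 and pi.\<close>

lemma fundamental_period_jacobi_sn_sq:
  assumes k: "0 < k" "k < 1" and nu: "0 < nu"
  shows "fundamental_period (\<lambda>x. (jacobi_sn k (nu * x))\<^sup>2) (elliptic_F k pi / nu)"
proof -
  have pos: "0 < elliptic_F k pi"
    using elliptic_F_expanding[OF k, of 0 pi] by (simp add: elliptic_F_0 less_le_trans[OF pi_gt_zero])
  have "(jacobi_sn k (nu * (x + elliptic_F k pi / nu)))\<^sup>2 = (jacobi_sn k (nu * x))\<^sup>2" for x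
  proof -
    have "nu * (x + elliptic_F k pi / nu) = nu * x + elliptic_F k pi"
      using nu by (simp add: field_simps)
    then show ?thesis by (simp add: jacobi_sn_def jacobi_am_plus_period[OF k])
  qed
  moreover have "(jacobi_sn k (nu * S))\<^sup>2 \<noteq> (jacobi_sn k (nu * 0))\<^sup>2"
    if S: "0 < S" "S < elliptic_F k pi / nu" for S
  proof -
    let ?a = "jacobi_am k (nu * S)"
    have F: "0 < elliptic_F k ?a" "elliptic_F k ?a < elliptic_F k pi"
      using S nu by (auto simp: elliptic_F_jacobi_am[OF k] field_simps)
    have "\<not> ?a \<le> 0" using elliptic_F_expanding[OF k, of ?a 0] F elliptic_F_0[of k]
      by (cases "?a = 0") auto
    moreover have "\<not> ?a \<ge> pi" using elliptic_F_expanding[OF k, of pi ?a] F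
      by (cases "?a = pi") auto
    ultimately have "sin ?a > 0" by (intro sin_gt_zero) auto
    moreover have "jacobi_am k 0 = 0" by (metis jacobi_am_elliptic_F[OF k] elliptic_F_0)
    ultimately show ?thesis by (simp add: jacobi_sn_def)
  qed
  ultimately show ?thesis
    unfolding fundamental_period_def using pos nu by (metis add_0 divide_pos_pos)
qed

text \<open>Periods depend only on which arguments share a value, so the period of sn^2 passes to
  every injective function of it, whatever the type of the values.\<close>

lemma fundamental_period_cong:
  assumes "\<And>x y. f x = f y \<longleftrightarrow> g x = g y"
  shows "fundamental_period f T \<longleftrightarrow> fundamental_period g T"
  using assms by (simp add: fundamental_period_def)


section \<open>Differential equations of sn^2 and of the wave\<close>

text \<open>The derivative is 2 nu sn cn dn. In its square and in its own derivative cn and dn occur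
  only through their squares, hence both are polynomials in y.\<close>

lemma jacobi_sn_sq_derivs:
  fixes k nu :: real
  assumes k: "0 < k" "k < 1"
  defines "y \<equiv> \<lambda>x. (jacobi_sn k (nu * x))\<^sup>2"
  obtains y' where "\<And>x. DERIV y x :> y' x"
    and "\<And>x. DERIV y' x :> 2 * nu\<^sup>2 * (1 - 2 * (1 + k\<^sup>2) * y x + 3 * k\<^sup>2 * (y x)\<^sup>2)"
    and "\<And>x. (y' x)\<^sup>2 = 4 * nu\<^sup>2 * y x * (1 - y x) * (1 - k\<^sup>2 * y x)"
proof -
  define \<phi> where "\<phi> x = jacobi_am k (nu * x)" for x
  define d where "d x = sqrt (1 - k\<^sup>2 * (sin (\<phi> x))\<^sup>2)" for x
  define y' where "y' x = 2 * nu * sin (\<phi> x) * cos (\<phi> x) * d x" for x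
  have y: "y x = (sin (\<phi> x))\<^sup>2" for x
    by (simp add: y_def jacobi_sn_def \<phi>_def)
  have dpos: "0 < d x" for x
    unfolding d_def using modulus_radicand_pos[OF k] by simp
  have d2: "(d x)\<^sup>2 = 1 - k\<^sup>2 * (sin (\<phi> x))\<^sup>2" for x
    unfolding d_def using modulus_radicand_pos[OF k, of "\<phi> x"] by simp
  have c2: "(cos (\<phi> x))\<^sup>2 = 1 - (sin (\<phi> x))\<^sup>2" for x
    by (rule cos_squared_eq)
  have D\<phi> [derivative_intros]: "DERIV \<phi> x :> nu * d x" for x
  proof -
    have "DERIV (\<lambda>x. nu * x) x :> nu" by (auto intro!: derivative_eq_intros)
    from DERIV_cong[OF DERIV_chain2[OF DERIV_jacobi_am[OF k] this] mult.commute]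
    show ?thesis unfolding \<phi>_def[abs_def] d_def jacobi_sn_def .
  qed
  have Dd: "DERIV d x :> - (nu * k\<^sup>2 * sin (\<phi> x) * cos (\<phi> x))" for x
  proof -
    have "DERIV (\<lambda>x. 1 - k\<^sup>2 * (sin (\<phi> x))\<^sup>2) x :> - (2 * k\<^sup>2 * sin (\<phi> x) * cos (\<phi> x) * (nu * d x))"
      by (auto intro!: derivative_eq_intros simp: D\<phi>)
    moreover have "0 < 1 - k\<^sup>2 * (sin (\<phi> x))\<^sup>2" by (rule modulus_radicand_pos[OF k])
    ultimately have "DERIV d x :> inverse (d x) / 2 * - (2 * k\<^sup>2 * sin (\<phi> x) * cos (\<phi> x) * (nu * d x))"
      unfolding d_def[abs_def] by (rule DERIV_chain2[OF DERIV_real_sqrt, rotated])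
    then show ?thesis using dpos[of x] by (simp add: field_simps)
  qed
  show thesis
  proof
    fix x
    show "DERIV y x :> y' x"
      unfolding y y'_def by (auto intro!: derivative_eq_intros simp: y[abs_def])
    have "DERIV y' x :> 2 * nu * (cos (\<phi> x) * (nu * d x) * cos (\<phi> x) * d x
        - sin (\<phi> x) * (sin (\<phi> x) * (nu * d x)) * d x
        - sin (\<phi> x) * cos (\<phi> x) * (nu * k\<^sup>2 * sin (\<phi> x) * cos (\<phi> x)))"
      unfolding y'_def[abs_def]
      by (auto intro!: derivative_eq_intros Dd simp: algebra_simps)
    also have "2 * nu * (cos (\<phi> x) * (nu * d x) * cos (\<phi> x) * d x
        - sin (\<phi> x) * (sin (\<phi> x) * (nu * d x)) * d x
        - sin (\<phi> x) * cos (\<phi> x) * (nu * k\<^sup>2 * sin (\<phi> x) * cos (\<phi> x)))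
      = 2 * nu\<^sup>2 * ((cos (\<phi> x))\<^sup>2 * (d x)\<^sup>2 - (sin (\<phi> x))\<^sup>2 * (d x)\<^sup>2 - k\<^sup>2 * (sin (\<phi> x))\<^sup>2 * (cos (\<phi> x))\<^sup>2)"
      by (simp add: algebra_simps power2_eq_square)
    also have "\<dots> = 2 * nu\<^sup>2 * (1 - 2 * (1 + k\<^sup>2) * y x + 3 * k\<^sup>2 * (y x)\<^sup>2)"
      unfolding d2 c2 y by algebra
    finally show "DERIV y' x :> 2 * nu\<^sup>2 * (1 - 2 * (1 + k\<^sup>2) * y x + 3 * k\<^sup>2 * (y x)\<^sup>2)" .
    show "(y' x)\<^sup>2 = 4 * nu\<^sup>2 * y x * (1 - y x) * (1 - k\<^sup>2 * y x)"
      unfolding y'_def power_mult_distrib d2 c2 y by simp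
  qed
qed

lemma periodic_wave_derivs:
  fixes u1 u2 u3 u4 nu kappa c e :: real
  assumes order: "u4 < u2" "u2 < u1"
    and sum_zero: "u1 + u2 + u3 + u4 = 0"
    and nu: "4 * nu\<^sup>2 = (u1 - u3) * (u2 - u4)"
    and kappa: "0 < kappa" "kappa < 1" "4 * nu\<^sup>2 * kappa\<^sup>2 = (u1 - u2) * (u3 - u4)"
    and c: "c = - (u1 * u2 + u1 * u3 + u1 * u4 + u2 * u3 + u2 * u4 + u3 * u4)"
    and e: "2 * e = u1 * u2 * u3 + u1 * u2 * u4 + u1 * u3 * u4 + u2 * u3 * u4"
  defines "u \<equiv> periodic_wave nu kappa (u1, u2, u3, u4)"
  obtains v where "\<And>x. DERIV u x :> v x"
    and "\<And>x. DERIV v x :> - 2 * (u x) ^ 3 + c * u x + e"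
    and "\<And>x. (v x)\<^sup>2 = - ((u x - u1) * (u x - u2) * (u x - u3) * (u x - u4))"
proof -
  define y where "y x = (jacobi_sn kappa (nu * x))\<^sup>2" for x
  define \<alpha> \<beta> \<delta> where abd_def: "\<alpha> = u1 - u4" "\<beta> = u2 - u4" "\<delta> = u1 - u2"
  define w where "w x = \<beta> + \<delta> * y x" for x
  obtain y' where y': "\<And>x. DERIV y x :> y' x"
    and y'': "\<And>x. DERIV y' x :> 2 * nu\<^sup>2 * (1 - 2 * (1 + kappa\<^sup>2) * y x + 3 * kappa\<^sup>2 * (y x)\<^sup>2)"
    and sq: "\<And>x. (y' x)\<^sup>2 = 4 * nu\<^sup>2 * y x * (1 - y x) * (1 - kappa\<^sup>2 * y x)"
    using jacobi_sn_sq_derivs[OF kappa(1,2), of nu] unfolding y_def[abs_def] by blast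
  have wpos: "0 < w x" for x
    using order by (auto simp: w_def y_def abd_def intro!: add_pos_nonneg)
  have u: "u = (\<lambda>x. u4 + \<alpha> * \<beta> / w x)"
    by (simp add: fun_eq_iff u_def periodic_wave_def w_def y_def abd_def)
  have Dw: "DERIV w x :> \<delta> * y' x" for x
    unfolding w_def[abs_def] by (auto intro!: derivative_eq_intros y')
  have u4: "u4 = - u1 - u2 - u3" using sum_zero by linarith
  have e': "e = (u1 * u2 * u3 + u1 * u2 * u4 + u1 * u3 * u4 + u2 * u3 * u4) / 2"
    using e by simp
  have uw: "u x = (u4 * w x + \<alpha> * \<beta>) / w x" for x
    using wpos[of x] by (simp add: u field_simps)
  \<comment> \<open>These are 4 nu^2 kappa^2 and 4 nu^2; using them removes \<open>nu\<close> and
    \<open>kappa\<close> from all later identities.\<close>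
  define m n where mn_def: "m = (u1 - u2) * (u3 - u4)" "n = (u1 - u3) * (u2 - u4)"
  have sq': "(y' x)\<^sup>2 = y x * (1 - y x) * (n - m * y x)" for x
    unfolding sq mn_def nu[symmetric] kappa(3)[symmetric] by algebra
  have y''': "2 * nu\<^sup>2 * (1 - 2 * (1 + kappa\<^sup>2) * y x + 3 * kappa\<^sup>2 * (y x)\<^sup>2)
      = n / 2 - (n + m) * y x + 3 / 2 * m * (y x)\<^sup>2" for x
    unfolding mn_def nu[symmetric] kappa(3)[symmetric] by (simp add: field_simps)
  show thesis
  proof
    fix x
    show "DERIV u x :> - (\<alpha> * \<beta> * \<delta> * y' x / (w x)\<^sup>2)"
      unfolding u using wpos[of x]
      by (auto intro!: derivative_eq_intros Dw simp: power2_eq_square)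
    \<comment> \<open>The wave takes the values \<open>u1\<close>, \<open>u2\<close>,
      \<open>u3\<close> at y = 0, 1, n/m and \<open>u4\<close> at infinity, so each difference is a
      linear factor or a constant over the common denominator. Their product matches the product in
      \<open>sq'\<close>.\<close>
    have f: "u x - u1 = - \<alpha> * \<delta> * y x / w x" "u x - u2 = \<beta> * \<delta> * (1 - y x) / w x"
       "u x - u3 = (n - m * y x) / w x" "u x - u4 = \<alpha> * \<beta> / w x"
      unfolding uw using wpos[of x]
      by (auto simp: divide_simps) (auto simp: w_def abd_def mn_def algebra_simps)
    \<comment> \<open>The second derivative is computed directly and recognised as -P'(u)/2, with P
      the monic quartic with roots \<open>u1\<close>, ..., \<open>u4\<close>. Differentiating the
      first integral would give this only where u' is nonzero.\<close>
    have "DERIV (\<lambda>x. - (\<alpha> * \<beta> * \<delta> * y' x / (w x)\<^sup>2)) x :>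
       - (\<alpha> * \<beta> * \<delta> * ((n / 2 - (n + m) * y x + 3 / 2 * m * (y x)\<^sup>2) * w x - 2 * \<delta> * (y' x)\<^sup>2)) / (w x) ^ 3"
      using wpos[of x] unfolding y'''[symmetric]
      by (auto intro!: derivative_eq_intros Dw y'' simp: field_simps power2_eq_square power3_eq_cube)
    also have "- (\<alpha> * \<beta> * \<delta> * ((n / 2 - (n + m) * y x + 3 / 2 * m * (y x)\<^sup>2) * w x - 2 * \<delta> * (y' x)\<^sup>2)) / (w x) ^ 3
        = - ((u x - u2) * (u x - u3) * (u x - u4) + (u x - u1) * (u x - u3) * (u x - u4)
          + (u x - u1) * (u x - u2) * (u x - u4) + (u x - u1) * (u x - u2) * (u x - u3)) / 2"
    proof -
      define \<gamma> where "\<gamma> = u3 - u4"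
      have g: "n = \<beta> * (\<beta> + \<delta> - \<gamma>)" "m = \<delta> * \<gamma>" "\<alpha> = \<beta> + \<delta>"
        by (simp_all add: mn_def abd_def \<gamma>_def algebra_simps)
      have num: "2 * (\<alpha> * \<beta> * \<delta> * ((n / 2 - (n + m) * y x + 3 / 2 * m * (y x)\<^sup>2) * w x - 2 * \<delta> * (y' x)\<^sup>2))
        = \<beta> * \<delta> * (1 - y x) * (n - m * y x) * (\<alpha> * \<beta>) + (- \<alpha> * \<delta> * y x) * (n - m * y x) * (\<alpha> * \<beta>)
          + (- \<alpha> * \<delta> * y x) * (\<beta> * \<delta> * (1 - y x)) * (\<alpha> * \<beta>)
          + (- \<alpha> * \<delta> * y x) * (\<beta> * \<delta> * (1 - y x)) * (n - m * y x)"
        unfolding sq' g w_def by (simp add: field_simps power2_eq_square)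
      have sum: "(u x - u2) * (u x - u3) * (u x - u4) + (u x - u1) * (u x - u3) * (u x - u4)
          + (u x - u1) * (u x - u2) * (u x - u4) + (u x - u1) * (u x - u2) * (u x - u3)
        = (\<beta> * \<delta> * (1 - y x) * (n - m * y x) * (\<alpha> * \<beta>) + (- \<alpha> * \<delta> * y x) * (n - m * y x) * (\<alpha> * \<beta>)
          + (- \<alpha> * \<delta> * y x) * (\<beta> * \<delta> * (1 - y x)) * (\<alpha> * \<beta>)
          + (- \<alpha> * \<delta> * y x) * (\<beta> * \<delta> * (1 - y x)) * (n - m * y x)) / (w x) ^ 3"
        unfolding f by (simp only: times_divide_times_eq add_divide_distrib power3_eq_cube)
      show ?thesis unfolding sum num[symmetric] by simp
    qed
    also have "\<dots> = - 2 * (u x) ^ 3 + c * u x + e"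
      unfolding c e' u4 by (simp add: field_simps power2_eq_square power3_eq_cube)
    finally show "DERIV (\<lambda>x. - (\<alpha> * \<beta> * \<delta> * y' x / (w x)\<^sup>2)) x :> - 2 * (u x) ^ 3 + c * u x + e" .
    show "(- (\<alpha> * \<beta> * \<delta> * y' x / (w x)\<^sup>2))\<^sup>2 = - ((u x - u1) * (u x - u2) * (u x - u3) * (u x - u4))"
      unfolding f power2_minus power_divide power_mult_distrib sq' using wpos[of x]
      by (simp add: field_simps power2_eq_square)
  qed
qed


section \<open>Existence of the periodic eigenfunctions\<close>

text \<open>The hypothesis \<open>energy\<close> is the compatibility relation (p^2 + q^2)^2 = (p^2
  - q^2)^2 + (2 p q)^2 of the prescribed squared components, and \<open>nz\<close> makes the
  division in the quadrature legitimate. The solution built has normalising factor 1.\<close>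

lemma periodic_eigenfunction_exists:
  fixes u v :: "real \<Rightarrow> real"
  assumes u: "\<And>x. DERIV u x :> v x"
    and v: "\<And>x. DERIV v x :> - 2 * (u x) ^ 3 + c * u x + e"
    and energy: "\<And>x. (e + 4 * l\<^sup>2 * u x)\<^sup>2 = (2 * l * v x)\<^sup>2 + (l * (c - 4 * l\<^sup>2 - 2 * (u x)\<^sup>2))\<^sup>2"
    and nz: "\<And>x. e + 4 * l\<^sup>2 * u x \<noteq> 0"
  shows "\<exists>p q. periodic_eigenfunction u c e l p q"
proof -
  define A B C where ABC_def: "A x = complex_of_real (e + 4 * l\<^sup>2 * u x)"
      "B x = complex_of_real (2 * l * v x)"
      "C x = complex_of_real (l * (c - 4 * l\<^sup>2 - 2 * (u x)\<^sup>2))" for x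
  \<comment> \<open>With \<open>w = p + \<i> * q\<close> and \<open>z = p - \<i> * q\<close> the constraints read \<open>w\<^sup>2 = H\<close> and \<open>w * z = A\<close>; these turn the
    system into the scalar equation \<open>w' = (l * A / H - \<i> * u) * w\<close>, solved by a quadrature.\<close>
  define H where "H x = B x + \<i> * C x" for x
  define U where "U x = complex_of_real (u x)" for x
  let ?l = "complex_of_real l"
  have ABC: "(A x)\<^sup>2 = (B x)\<^sup>2 + (C x)\<^sup>2" for x
    unfolding ABC_def using energy[of x] by (metis of_real_add of_real_power)
  have Anz: "A x \<noteq> 0" for x
    unfolding ABC_def using nz[of x] by (simp only: of_real_eq_0_iff not_False_eq_True)
  have HH: "H x * (B x - \<i> * C x) = (A x)\<^sup>2" for x
    unfolding H_def ABC by (simp add: algebra_simps power2_eq_square)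
  have Hnz: "H x \<noteq> 0" for x using HH[of x] Anz[of x] by auto
  have DA: "(A has_vector_derivative 2 * ?l * B x) (at x)" for x
  proof -
    have "DERIV (\<lambda>x. e + 4 * l\<^sup>2 * u x) x :> 2 * l * (2 * l * v x)"
      by (auto intro!: derivative_eq_intros u simp: power2_eq_square)
    then have "((\<lambda>x. complex_of_real (e + 4 * l\<^sup>2 * u x)) has_vector_derivative
        complex_of_real (2 * l * (2 * l * v x))) (at x)"
      by (intro has_vector_derivative_of_real) (simp add: has_real_derivative_iff_has_vector_derivative)
    then show ?thesis unfolding ABC_def[abs_def] by simp
  qed
  have DB: "(B has_vector_derivative 2 * ?l * A x + 2 * U x * C x) (at x)" for x
  proof -
    have "DERIV (\<lambda>x. 2 * l * v x) x :>
        2 * l * (e + 4 * l\<^sup>2 * u x) + 2 * u x * (l * (c - 4 * l\<^sup>2 - 2 * (u x)\<^sup>2))"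
      by (auto intro!: derivative_eq_intros v simp: algebra_simps power2_eq_square power3_eq_cube)
    then have "((\<lambda>x. complex_of_real (2 * l * v x)) has_vector_derivative complex_of_real
        (2 * l * (e + 4 * l\<^sup>2 * u x) + 2 * u x * (l * (c - 4 * l\<^sup>2 - 2 * (u x)\<^sup>2)))) (at x)"
      by (intro has_vector_derivative_of_real) (simp add: has_real_derivative_iff_has_vector_derivative)
    then show ?thesis unfolding ABC_def[abs_def] U_def by simp
  qed
  have DC: "(C has_vector_derivative - 2 * U x * B x) (at x)" for x
  proof -
    have "DERIV (\<lambda>x. l * (c - 4 * l\<^sup>2 - 2 * (u x)\<^sup>2)) x :> - 2 * u x * (2 * l * v x)"
      by (auto intro!: derivative_eq_intros u simp: algebra_simps power2_eq_square)
    then have "((\<lambda>x. complex_of_real (l * (c - 4 * l\<^sup>2 - 2 * (u x)\<^sup>2))) has_vector_derivative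
        complex_of_real (- 2 * u x * (2 * l * v x))) (at x)"
      by (intro has_vector_derivative_of_real) (simp add: has_real_derivative_iff_has_vector_derivative)
    then show ?thesis unfolding ABC_def[abs_def] U_def by simp
  qed
  have DH: "(H has_vector_derivative 2 * ?l * A x - 2 * \<i> * U x * H x) (at x)" for x
    unfolding H_def[abs_def]
    by (rule has_vector_derivative_eq_rhs, rule has_vector_derivative_add[OF DB
          has_vector_derivative_mult_right[OF DC]]) (simp add: algebra_simps)
  define g where "g x = ?l * A x / H x - \<i> * U x" for x
  have cont: "isCont A x" "isCont H x" "isCont U x" for x
    using DA DH DERIV_isCont[OF u]
    by (auto intro: has_vector_derivative_continuous intro!: continuous_intros simp: U_def[abs_def])
  have "isCont g x" for x
    unfolding g_def[abs_def] using Hnz[of x] by (intro continuous_intros cont) auto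
  then obtain G where DG: "\<And>x. (G has_vector_derivative g x) (at x)"
    using einterval_antiderivative[of "-\<infinity>" "\<infinity>" g] by auto
  have DE: "((\<lambda>x. exp (r * G x)) has_vector_derivative r * g x * exp (r * G x)) (at x)" for x r
    using field_vector_diff_chain_at[OF has_vector_derivative_mult_right[OF DG] DERIV_exp, of r x]
    by (simp add: o_def)
  \<comment> \<open>Since H' = 2 g H, the function H is a constant multiple of exp(2 G). A square
    root of that one constant gives a smooth global square root of H, with no choice of branch along
    the line.\<close>
  have "((\<lambda>x. H x * exp (- 2 * G x)) has_vector_derivative 0) (at x)" for x
    using has_vector_derivative_mult[OF DH[of x] DE[of "-2" x]] Hnz[of x]
    by (simp add: g_def field_simps)
  then obtain K where K: "\<And>x. H x * exp (- 2 * G x) = K"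
    using has_vector_derivative_zero_constant[of UNIV "\<lambda>x. H x * exp (- 2 * G x)"] by auto
  define w where "w x = csqrt K * exp (1 * G x)" for x
  \<comment> \<open>This is A / w written without dividing by w, so that the product rule applies
    directly.\<close>
  define z where "z x = A x * (inverse (csqrt K) * exp (- 1 * G x))" for x
  have Knz: "K \<noteq> 0" using K[of 0] Hnz[of 0] by auto
  have w2: "(w x)\<^sup>2 = H x" for x
    unfolding w_def power_mult_distrib power2_csqrt K[of x, symmetric]
    by (simp add: exp_minus power2_eq_square exp_double[symmetric] exp_add[symmetric])
  have wz: "w x * z x = A x" for x
    unfolding w_def z_def using Knz by (simp add: exp_minus field_simps)
  have wnz: "w x \<noteq> 0" for x using wz[of x] Anz[of x] by auto
  have z2: "(z x)\<^sup>2 = B x - \<i> * C x" for x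
  proof -
    have "H x * (z x)\<^sup>2 = H x * (B x - \<i> * C x)"
      unfolding HH wz[symmetric] by (simp add: power_mult_distrib w2)
    then show ?thesis using Hnz[of x] by simp
  qed
  have Dw: "(w has_vector_derivative ?l * z x - \<i> * U x * w x) (at x)" for x
  proof -
    have "(w has_vector_derivative csqrt K * (1 * g x * exp (1 * G x))) (at x)"
      unfolding w_def[abs_def] by (rule has_vector_derivative_mult_right[OF DE])
    also have "csqrt K * (1 * g x * exp (1 * G x)) = g x * w x" by (simp add: w_def)
    also have "\<dots> = ?l * z x - \<i> * U x * w x"
      unfolding g_def wz[symmetric] w2[symmetric] using wnz[of x]
      by (simp add: field_simps power2_eq_square)
    finally show ?thesis .
  qed
  have Dz: "(z has_vector_derivative ?l * w x + \<i> * U x * z x) (at x)" for x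
  proof -
    have "(z has_vector_derivative A x * (inverse (csqrt K) * (- 1 * g x * exp (- 1 * G x)))
        + 2 * ?l * B x * (inverse (csqrt K) * exp (- 1 * G x))) (at x)"
      unfolding z_def[abs_def]
      by (rule has_vector_derivative_mult[OF DA has_vector_derivative_mult_right[OF DE]])
    also have "A x * (inverse (csqrt K) * (- 1 * g x * exp (- 1 * G x)))
        + 2 * ?l * B x * (inverse (csqrt K) * exp (- 1 * G x))
      = (2 * ?l * B x - g x * A x) / w x"
      unfolding w_def using Knz by (simp add: field_simps exp_minus)
    also have "2 * ?l * B x = ?l * ((w x)\<^sup>2 + (z x)\<^sup>2)"
      unfolding w2 z2 H_def by simp
    also have "(?l * ((w x)\<^sup>2 + (z x)\<^sup>2) - g x * A x) / w x = ?l * w x + \<i> * U x * z x"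
      unfolding g_def wz[symmetric] w2[symmetric] using wnz[of x]
      by (simp add: field_simps power2_eq_square)
    finally show ?thesis .
  qed
  define p q where pq_def: "p x = 1 / 2 * (w x + z x)" "q x = - \<i> / 2 * (w x - z x)" for x
  have "(p has_vector_derivative of_real l * p x + of_real (u x) * q x) (at x)" for x
    unfolding pq_def[abs_def]
    by (rule has_vector_derivative_eq_rhs,
        rule has_vector_derivative_mult_right[OF has_vector_derivative_add[OF Dw Dz]])
      (simp add: U_def field_simps)
  moreover have "(q has_vector_derivative - of_real (u x) * p x - of_real l * q x) (at x)" for x
    unfolding pq_def[abs_def]
    by (rule has_vector_derivative_eq_rhs,
        rule has_vector_derivative_mult_right[OF has_vector_derivative_diff[OF Dw Dz]])
      (simp add: U_def field_simps)
  moreover have "(p x)\<^sup>2 + (q x)\<^sup>2 = A x" "(p x)\<^sup>2 - (q x)\<^sup>2 = B x" "2 * p x * q x = C x" for x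
  proof -
    show "(p x)\<^sup>2 + (q x)\<^sup>2 = A x"
      unfolding pq_def wz[symmetric] by (simp add: power_mult_distrib power2_eq_square field_simps)
    have "(p x)\<^sup>2 - (q x)\<^sup>2 = ((w x)\<^sup>2 + (z x)\<^sup>2) / 2" "2 * p x * q x = - \<i> * ((w x)\<^sup>2 - (z x)\<^sup>2) / 2"
      unfolding pq_def by (simp_all add: power_mult_distrib power2_eq_square field_simps)
    then show "(p x)\<^sup>2 - (q x)\<^sup>2 = B x" "2 * p x * q x = C x"
      unfolding w2 z2 H_def by (simp_all add: algebra_simps)
  qed
  moreover have "deriv u x = v x" for x using u by (rule DERIV_imp_deriv)
  ultimately show ?thesis
    unfolding periodic_eigenfunction_def ABC_def
    by (intro exI[of _ p] exI[of _ q] conjI exI[of _ 1]) auto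
qed


section \<open>Polynomial identities for the two-fold and three-fold formulas\<close>

text \<open>Here \<open>v\<close> stands for u', and \<open>a\<close>, \<open>g\<close> belong to
  \<open>l\<close>, their primed versions to the other eigenvalues. Once M M' is factored out, only
  v^2 remains; substituting the first integral leaves a polynomial identity in u and the
  eigenvalues. The surviving \<open>a''\<close> belongs to the eigenvalue that takes no part in the
  transformation.\<close>

lemma twofold_den_reduced:
  fixes M M' l l' l'' u v a a' a'' g g' p q p' q' :: complex
  assumes p: "p\<^sup>2 + q\<^sup>2 = 4 * M * a" "p\<^sup>2 - q\<^sup>2 = 2 * M * v" "p * q = M * g"
    and p': "p'\<^sup>2 + q'\<^sup>2 = 4 * M' * a'" "p'\<^sup>2 - q'\<^sup>2 = 2 * M' * v" "p' * q' = M' * g'"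
    and a: "a = l * u - l' * l''" "a' = l' * u - l * l''" "a'' = l'' * u - l * l'"
    and g: "g = l'\<^sup>2 + l''\<^sup>2 - l\<^sup>2 - u\<^sup>2" "g' = l\<^sup>2 + l''\<^sup>2 - l'\<^sup>2 - u\<^sup>2"
    and v: "v\<^sup>2 = 4 * a\<^sup>2 - g\<^sup>2"
  shows "twofold_den l p q l' p' q' = - 16 * M * M' * (l\<^sup>2 - l'\<^sup>2)\<^sup>2 * a''"
proof -
  have "twofold_den l p q l' p' q' =
      (l\<^sup>2 + l'\<^sup>2) * (p\<^sup>2 + q\<^sup>2) * (p'\<^sup>2 + q'\<^sup>2)
      - 2 * l * l' * (4 * (p * q) * (p' * q') + (p\<^sup>2 - q\<^sup>2) * (p'\<^sup>2 - q'\<^sup>2))"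
    by (simp add: twofold_den_def mult.assoc)
  also have "\<dots> = M * M' * (16 * (l\<^sup>2 + l'\<^sup>2) * a * a' - 8 * l * l' * (g * g' + v\<^sup>2))"
    unfolding p p' by (simp add: algebra_simps power2_eq_square)
  also have "16 * (l\<^sup>2 + l'\<^sup>2) * a * a' - 8 * l * l' * (g * g' + v\<^sup>2) = - 16 * (l\<^sup>2 - l'\<^sup>2)\<^sup>2 * a''"
    unfolding v a g by algebra
  finally show ?thesis by (simp add: mult_ac)
qed

text \<open>The numerator involves only p q and p^2 + q^2, so the derivative of u does not enter.
  Its prefactor cancels against that of the denominator.\<close>

lemma twofold_num_reduced:
  fixes M M' l l' l'' u a a' a'' g g' g'' p q p' q' :: complex
  assumes p: "p\<^sup>2 + q\<^sup>2 = 4 * M * a" "p * q = M * g"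
    and p': "p'\<^sup>2 + q'\<^sup>2 = 4 * M' * a'" "p' * q' = M' * g'"
    and a: "a = l * u - l' * l''" "a' = l' * u - l * l''" "a'' = l'' * u - l * l'"
    and g: "g = l'\<^sup>2 + l''\<^sup>2 - l\<^sup>2 - u\<^sup>2" "g' = l\<^sup>2 + l''\<^sup>2 - l'\<^sup>2 - u\<^sup>2"
      "g'' = l\<^sup>2 + l'\<^sup>2 - l''\<^sup>2 - u\<^sup>2"
  shows "twofold_num l p q l' p' q' = 4 * M * M' * (l\<^sup>2 - l'\<^sup>2)\<^sup>2 * (2 * u * a'' + l'' * g'')"
proof -
  have "twofold_num l p q l' p' q' =
      (l\<^sup>2 - l'\<^sup>2) * (l * (p * q) * (p'\<^sup>2 + q'\<^sup>2) - l' * (p' * q') * (p\<^sup>2 + q\<^sup>2))"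
    by (simp add: twofold_num_def mult.assoc)
  also have "\<dots> = 4 * M * M' * ((l\<^sup>2 - l'\<^sup>2) * (l * g * a' - l' * g' * a))"
    unfolding p p' by (simp add: algebra_simps)
  also have "(l\<^sup>2 - l'\<^sup>2) * (l * g * a' - l' * g' * a) = (l\<^sup>2 - l'\<^sup>2)\<^sup>2 * (2 * u * a'' + l'' * g'')"
    unfolding a g by algebra
  finally show ?thesis by (simp add: mult_ac)
qed

text \<open>The squared factor is the discriminant of the three squared eigenvalues. It also occurs
  in \<open>threefold_den_reduced\<close>, and the quotient of the two is -u/2.\<close>

lemma threefold_num_reduced:
  fixes M1 M2 M3 l1 l2 l3 u v a1 a2 a3 g1 g2 g3 p1 q1 p2 q2 p3 q3 :: complex
  assumes p1: "p1\<^sup>2 + q1\<^sup>2 = 4 * M1 * a1" "p1\<^sup>2 - q1\<^sup>2 = 2 * M1 * v" "p1 * q1 = M1 * g1"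
    and p2: "p2\<^sup>2 + q2\<^sup>2 = 4 * M2 * a2" "p2\<^sup>2 - q2\<^sup>2 = 2 * M2 * v" "p2 * q2 = M2 * g2"
    and p3: "p3\<^sup>2 + q3\<^sup>2 = 4 * M3 * a3" "p3\<^sup>2 - q3\<^sup>2 = 2 * M3 * v" "p3 * q3 = M3 * g3"
    and a: "a1 = l1 * u - l2 * l3" "a2 = l2 * u - l1 * l3" "a3 = l3 * u - l1 * l2"
    and g: "g1 = l2\<^sup>2 + l3\<^sup>2 - l1\<^sup>2 - u\<^sup>2" "g2 = l1\<^sup>2 + l3\<^sup>2 - l2\<^sup>2 - u\<^sup>2"
      "g3 = l1\<^sup>2 + l2\<^sup>2 - l3\<^sup>2 - u\<^sup>2"
    and v: "v\<^sup>2 = 4 * a1\<^sup>2 - g1\<^sup>2"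
  shows "threefold_num l1 p1 q1 l2 p2 q2 l3 p3 q3 =
    32 * M1 * M2 * M3 * ((l1\<^sup>2 - l2\<^sup>2) * (l1\<^sup>2 - l3\<^sup>2) * (l2\<^sup>2 - l3\<^sup>2))\<^sup>2 * u"
proof -
  have "threefold_num l1 p1 q1 l2 p2 q2 l3 p3 q3 =
      (l3\<^sup>2 - l1\<^sup>2) * (l3\<^sup>2 - l2\<^sup>2) * l3 * (p3 * q3) *
         ((l1\<^sup>2 + l2\<^sup>2) * (p1\<^sup>2 + q1\<^sup>2) * (p2\<^sup>2 + q2\<^sup>2)
          - 2 * l1 * l2 * (p1\<^sup>2 - q1\<^sup>2) * (p2\<^sup>2 - q2\<^sup>2))
       + (l2\<^sup>2 - l1\<^sup>2) * (l2\<^sup>2 - l3\<^sup>2) * l2 * (p2 * q2) *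
         ((l1\<^sup>2 + l3\<^sup>2) * (p1\<^sup>2 + q1\<^sup>2) * (p3\<^sup>2 + q3\<^sup>2)
          - 2 * l1 * l3 * (p1\<^sup>2 - q1\<^sup>2) * (p3\<^sup>2 - q3\<^sup>2))
       + (l1\<^sup>2 - l2\<^sup>2) * (l1\<^sup>2 - l3\<^sup>2) * l1 * (p1 * q1) *
         ((l2\<^sup>2 + l3\<^sup>2) * (p2\<^sup>2 + q2\<^sup>2) * (p3\<^sup>2 + q3\<^sup>2)
          - 2 * l2 * l3 * (p2\<^sup>2 - q2\<^sup>2) * (p3\<^sup>2 - q3\<^sup>2))
       - 8 * (l1 ^ 4 + l2 ^ 4 + l3 ^ 4 - l1\<^sup>2 * l2\<^sup>2 - l1\<^sup>2 * l3\<^sup>2 - l2\<^sup>2 * l3\<^sup>2)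
         * l1 * l2 * l3 * (p1 * q1) * (p2 * q2) * (p3 * q3)"
    by (simp add: threefold_num_def mult_ac)
  also have "\<dots> = 8 * M1 * M2 * M3 *
      ((l3\<^sup>2 - l1\<^sup>2) * (l3\<^sup>2 - l2\<^sup>2) * l3 * g3 * (2 * (l1\<^sup>2 + l2\<^sup>2) * a1 * a2 - l1 * l2 * v\<^sup>2)
       + (l2\<^sup>2 - l1\<^sup>2) * (l2\<^sup>2 - l3\<^sup>2) * l2 * g2 * (2 * (l1\<^sup>2 + l3\<^sup>2) * a1 * a3 - l1 * l3 * v\<^sup>2)
       + (l1\<^sup>2 - l2\<^sup>2) * (l1\<^sup>2 - l3\<^sup>2) * l1 * g1 * (2 * (l2\<^sup>2 + l3\<^sup>2) * a2 * a3 - l2 * l3 * v\<^sup>2)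
       - (l1 ^ 4 + l2 ^ 4 + l3 ^ 4 - l1\<^sup>2 * l2\<^sup>2 - l1\<^sup>2 * l3\<^sup>2 - l2\<^sup>2 * l3\<^sup>2)
         * l1 * l2 * l3 * g1 * g2 * g3)"
    unfolding p1 p2 p3 by algebra
  also have "(l3\<^sup>2 - l1\<^sup>2) * (l3\<^sup>2 - l2\<^sup>2) * l3 * g3 * (2 * (l1\<^sup>2 + l2\<^sup>2) * a1 * a2 - l1 * l2 * v\<^sup>2)
       + (l2\<^sup>2 - l1\<^sup>2) * (l2\<^sup>2 - l3\<^sup>2) * l2 * g2 * (2 * (l1\<^sup>2 + l3\<^sup>2) * a1 * a3 - l1 * l3 * v\<^sup>2)
       + (l1\<^sup>2 - l2\<^sup>2) * (l1\<^sup>2 - l3\<^sup>2) * l1 * g1 * (2 * (l2\<^sup>2 + l3\<^sup>2) * a2 * a3 - l2 * l3 * v\<^sup>2)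
       - (l1 ^ 4 + l2 ^ 4 + l3 ^ 4 - l1\<^sup>2 * l2\<^sup>2 - l1\<^sup>2 * l3\<^sup>2 - l2\<^sup>2 * l3\<^sup>2)
         * l1 * l2 * l3 * g1 * g2 * g3
    = 4 * ((l1\<^sup>2 - l2\<^sup>2) * (l1\<^sup>2 - l3\<^sup>2) * (l2\<^sup>2 - l3\<^sup>2))\<^sup>2 * u"
    unfolding v a g by algebra
  finally show ?thesis by (simp add: mult_ac)
qed

lemma threefold_den_reduced:
  fixes M1 M2 M3 l1 l2 l3 u v a1 a2 a3 g1 g2 g3 p1 q1 p2 q2 p3 q3 :: complex
  assumes p1: "p1\<^sup>2 + q1\<^sup>2 = 4 * M1 * a1" "p1\<^sup>2 - q1\<^sup>2 = 2 * M1 * v" "p1 * q1 = M1 * g1"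
    and p2: "p2\<^sup>2 + q2\<^sup>2 = 4 * M2 * a2" "p2\<^sup>2 - q2\<^sup>2 = 2 * M2 * v" "p2 * q2 = M2 * g2"
    and p3: "p3\<^sup>2 + q3\<^sup>2 = 4 * M3 * a3" "p3\<^sup>2 - q3\<^sup>2 = 2 * M3 * v" "p3 * q3 = M3 * g3"
    and a: "a1 = l1 * u - l2 * l3" "a2 = l2 * u - l1 * l3" "a3 = l3 * u - l1 * l2"
    and g: "g1 = l2\<^sup>2 + l3\<^sup>2 - l1\<^sup>2 - u\<^sup>2" "g2 = l1\<^sup>2 + l3\<^sup>2 - l2\<^sup>2 - u\<^sup>2"
      "g3 = l1\<^sup>2 + l2\<^sup>2 - l3\<^sup>2 - u\<^sup>2"
    and v: "v\<^sup>2 = 4 * a1\<^sup>2 - g1\<^sup>2"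
  shows "threefold_den l1 p1 q1 l2 p2 q2 l3 p3 q3 =
    - 64 * M1 * M2 * M3 * ((l1\<^sup>2 - l2\<^sup>2) * (l1\<^sup>2 - l3\<^sup>2) * (l2\<^sup>2 - l3\<^sup>2))\<^sup>2"
proof -
  have sq: "p1\<^sup>2 = M1 * (2 * a1 + v)" "q1\<^sup>2 = M1 * (2 * a1 - v)"
    "p2\<^sup>2 = M2 * (2 * a2 + v)" "q2\<^sup>2 = M2 * (2 * a2 - v)"
    "p3\<^sup>2 = M3 * (2 * a3 + v)" "q3\<^sup>2 = M3 * (2 * a3 - v)"
    using p1 p2 p3 by algebra+
  \<comment> \<open>Each bracket of the denominator adds a product to its mirror image under v to
    -v, so odd powers of v cancel. Up to 4 M1 M2 M3, \<open>?T\<close> is the even part of such a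
    pair.\<close>
  let ?T = "\<lambda>a b c. 4 * a * b * c + (a - b - c) * v\<^sup>2"
  have "threefold_den l1 p1 q1 l2 p2 q2 l3 p3 q3 =
      (l1 + l2)\<^sup>2 * (l1 + l3)\<^sup>2 * (l2 - l3)\<^sup>2 * (p1\<^sup>2 * q2\<^sup>2 * q3\<^sup>2 + q1\<^sup>2 * p2\<^sup>2 * p3\<^sup>2)
     + (l1 + l2)\<^sup>2 * (l2 + l3)\<^sup>2 * (l1 - l3)\<^sup>2 * (p2\<^sup>2 * q1\<^sup>2 * q3\<^sup>2 + q2\<^sup>2 * p1\<^sup>2 * p3\<^sup>2)
     + (l1 + l3)\<^sup>2 * (l2 + l3)\<^sup>2 * (l1 - l2)\<^sup>2 * (p3\<^sup>2 * q1\<^sup>2 * q2\<^sup>2 + q3\<^sup>2 * p1\<^sup>2 * p2\<^sup>2)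
     + (l1 - l2)\<^sup>2 * (l1 - l3)\<^sup>2 * (l2 - l3)\<^sup>2 * (p1\<^sup>2 * p2\<^sup>2 * p3\<^sup>2 + q1\<^sup>2 * q2\<^sup>2 * q3\<^sup>2)
     - 8 * (l3\<^sup>2 - l1\<^sup>2) * (l3\<^sup>2 - l2\<^sup>2) * l1 * l2 * (p1 * q1) * (p2 * q2) * (p3\<^sup>2 + q3\<^sup>2)
     - 8 * (l2\<^sup>2 - l1\<^sup>2) * (l2\<^sup>2 - l3\<^sup>2) * l1 * l3 * (p1 * q1) * (p3 * q3) * (p2\<^sup>2 + q2\<^sup>2)
     - 8 * (l1\<^sup>2 - l2\<^sup>2) * (l1\<^sup>2 - l3\<^sup>2) * l2 * l3 * (p2 * q2) * (p3 * q3) * (p1\<^sup>2 + q1\<^sup>2)"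
    by (simp add: threefold_den_def mult_ac)
  also have "\<dots> = 4 * M1 * M2 * M3 * (
       (l1 + l2)\<^sup>2 * (l1 + l3)\<^sup>2 * (l2 - l3)\<^sup>2 * ?T a1 a2 a3
     + (l1 + l2)\<^sup>2 * (l2 + l3)\<^sup>2 * (l1 - l3)\<^sup>2 * ?T a2 a1 a3
     + (l1 + l3)\<^sup>2 * (l2 + l3)\<^sup>2 * (l1 - l2)\<^sup>2 * ?T a3 a1 a2
     + (l1 - l2)\<^sup>2 * (l1 - l3)\<^sup>2 * (l2 - l3)\<^sup>2 * (4 * a1 * a2 * a3 + (a1 + a2 + a3) * v\<^sup>2)
     - 8 * (l3\<^sup>2 - l1\<^sup>2) * (l3\<^sup>2 - l2\<^sup>2) * l1 * l2 * g1 * g2 * a3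
     - 8 * (l2\<^sup>2 - l1\<^sup>2) * (l2\<^sup>2 - l3\<^sup>2) * l1 * l3 * g1 * g3 * a2
     - 8 * (l1\<^sup>2 - l2\<^sup>2) * (l1\<^sup>2 - l3\<^sup>2) * l2 * l3 * g2 * g3 * a1)"
  proof -
    have T: "M * (2 * a + v) * (M' * (2 * a' - v)) * (M'' * (2 * a'' - v))
        + M * (2 * a - v) * (M' * (2 * a' + v)) * (M'' * (2 * a'' + v)) = 4 * (M * M' * M'' * ?T a a' a'')"
      "M * (2 * a + v) * (M' * (2 * a' + v)) * (M'' * (2 * a'' + v))
        + M * (2 * a - v) * (M' * (2 * a' - v)) * (M'' * (2 * a'' - v))
       = 4 * (M * M' * M'' * (4 * a * a' * a'' + (a + a' + a'') * v\<^sup>2))"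
      for M M' M'' a a' a'' by algebra+
    show ?thesis
      unfolding p1(1,3) p2(1,3) p3(1,3) sq T by (simp add: distrib_left right_diff_distrib mult_ac)
  qed
  also have "(l1 + l2)\<^sup>2 * (l1 + l3)\<^sup>2 * (l2 - l3)\<^sup>2 * ?T a1 a2 a3
     + (l1 + l2)\<^sup>2 * (l2 + l3)\<^sup>2 * (l1 - l3)\<^sup>2 * ?T a2 a1 a3
     + (l1 + l3)\<^sup>2 * (l2 + l3)\<^sup>2 * (l1 - l2)\<^sup>2 * ?T a3 a1 a2
     + (l1 - l2)\<^sup>2 * (l1 - l3)\<^sup>2 * (l2 - l3)\<^sup>2 * (4 * a1 * a2 * a3 + (a1 + a2 + a3) * v\<^sup>2)
     - 8 * (l3\<^sup>2 - l1\<^sup>2) * (l3\<^sup>2 - l2\<^sup>2) * l1 * l2 * g1 * g2 * a3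
     - 8 * (l2\<^sup>2 - l1\<^sup>2) * (l2\<^sup>2 - l3\<^sup>2) * l1 * l3 * g1 * g3 * a2
     - 8 * (l1\<^sup>2 - l2\<^sup>2) * (l1\<^sup>2 - l3\<^sup>2) * l2 * l3 * g2 * g3 * a1
    = - 16 * ((l1\<^sup>2 - l2\<^sup>2) * (l1\<^sup>2 - l3\<^sup>2) * (l2\<^sup>2 - l3\<^sup>2))\<^sup>2"
    unfolding v a g by algebra
  finally show ?thesis by (simp add: mult_ac)
qed


section \<open>The wave as a Moebius function of sn^2\<close>

text \<open>The denominator is affine in y with end values t2 - t4 and t1 - t4 of equal sign. The
  sign condition is a product because the exchanges (S2) and (S3) make both values negative.\<close>

lemma periodic_wave_denominator_nonzero:
  fixes t1 t2 t4 y :: real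
  assumes "0 < (t1 - t4) * (t2 - t4)" "0 \<le> y" "y \<le> 1"
  shows "(t2 - t4) + (t1 - t2) * y \<noteq> 0"
proof -
  have "(t2 - t4) * ((t2 - t4) + (t1 - t2) * y) = (t2 - t4)\<^sup>2 * (1 - y) + (t1 - t4) * (t2 - t4) * y"
    by algebra
  also have "\<dots> > 0"
  proof (cases "y = 0")
    case True
    then show ?thesis using assms(1) by auto
  next
    case False
    then have "0 < y" using assms by simp
    note mult_pos_pos[OF assms(1) this]
    moreover have "0 \<le> (t2 - t4)\<^sup>2 * (1 - y)" using assms by simp
    ultimately show ?thesis by linarith
  qed
  finally show ?thesis by auto
qed

lemma jacobi_sn_sq_le_1: "(jacobi_sn k x)\<^sup>2 \<le> 1"
  by (simp add: jacobi_sn_def abs_square_le_1)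

lemma periodic_wave_times_denominator:
  assumes "0 < (t1 - t4) * (t2 - t4)"
  shows "periodic_wave nu k (t1, t2, t3, t4) x * ((t2 - t4) + (t1 - t2) * (jacobi_sn k (nu * x))\<^sup>2)
     = t4 * ((t2 - t4) + (t1 - t2) * (jacobi_sn k (nu * x))\<^sup>2) + (t1 - t4) * (t2 - t4)"
  using periodic_wave_denominator_nonzero[OF assms zero_le_power2 jacobi_sn_sq_le_1]
  by (simp add: periodic_wave_def distrib_right)

text \<open>A nonconstant Moebius function is injective, so every such wave has exactly the periods
  of sn^2.\<close>

lemma periodic_wave_eq_iff:
  assumes "0 < (t1 - t4) * (t2 - t4)" "t1 \<noteq> t2"
  shows "periodic_wave nu k (t1, t2, t3, t4) x = periodic_wave nu k (t1, t2, t3, t4) x'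
     \<longleftrightarrow> (jacobi_sn k (nu * x))\<^sup>2 = (jacobi_sn k (nu * x'))\<^sup>2"
proof -
  have "t1 \<noteq> t4" "t2 \<noteq> t4" using assms(1) by auto
  then show ?thesis
    using periodic_wave_denominator_nonzero[OF assms(1) zero_le_power2 jacobi_sn_sq_le_1] assms(2)
    by (auto simp: periodic_wave_def frac_eq_eq)
qed

lemma periodic_wave_bounds:
  fixes u1 u2 u3 u4 :: real
  assumes "u4 < u2" "u2 < u1"
  shows "u2 \<le> periodic_wave nu k (u1, u2, u3, u4) x" "periodic_wave nu k (u1, u2, u3, u4) x \<le> u1"
proof -
  define y where "y = (jacobi_sn k (nu * x))\<^sup>2"
  have y: "0 \<le> y" "y \<le> 1" by (simp_all add: y_def jacobi_sn_sq_le_1)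
  define w where "w = (u2 - u4) + (u1 - u2) * y"
  have w: "u2 - u4 \<le> w" "0 < w"
    using assms y by (auto simp: w_def intro!: add_pos_nonneg)
  have w': "w \<le> u1 - u4"
    using mult_left_mono[OF y(2), of "u1 - u2"] assms by (simp add: w_def algebra_simps)
  have u: "periodic_wave nu k (u1, u2, u3, u4) x = u4 + (u1 - u4) * (u2 - u4) / w"
    by (simp add: periodic_wave_def w_def y_def)
  have "(u2 - u4) * w \<le> (u1 - u4) * (u2 - u4)" "(u1 - u4) * (u2 - u4) \<le> (u1 - u4) * w"
    using assms w w' by (auto simp: mult.commute intro!: mult_right_mono mult_left_mono)
  then have "u2 - u4 \<le> (u1 - u4) * (u2 - u4) / w" "(u1 - u4) * (u2 - u4) / w \<le> u1 - u4"
    using w by (simp_all add: pos_le_divide_eq pos_divide_le_eq)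
  then show "u2 \<le> periodic_wave nu k (u1, u2, u3, u4) x" "periodic_wave nu k (u1, u2, u3, u4) x \<le> u1"
    unfolding u by linarith+
qed

section \<open>Darboux transformations evaluated on periodic eigenfunctions\<close>

text \<open>In terms of the eigenvalues all three right-hand sides contain the factor
  \<open>l\<close>. Absorbing it into the constant, M = m l, gives formulas in which p^2 - q^2 has
  the same shape for every eigenvalue.\<close>

lemma periodic_eigenfunction_squares:
  assumes "periodic_eigenfunction u c e l p q"
    and c: "c = 2 * (l\<^sup>2 + l'\<^sup>2 + l''\<^sup>2)" and e: "e = - 4 * l * l' * l''" and "l \<noteq> 0"
  obtains M where "M \<noteq> 0"
    and "\<And>x. (p x)\<^sup>2 + (q x)\<^sup>2 = 4 * M * of_real (l * u x - l' * l'')"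
    and "\<And>x. (p x)\<^sup>2 - (q x)\<^sup>2 = 2 * M * of_real (deriv u x)"
    and "\<And>x. p x * q x = M * of_real (l'\<^sup>2 + l''\<^sup>2 - l\<^sup>2 - (u x)\<^sup>2)"
proof -
  obtain m where m: "m \<noteq> 0"
    and sum: "\<And>x. (p x)\<^sup>2 + (q x)\<^sup>2 = m * of_real (e + 4 * l\<^sup>2 * u x)"
    and diff: "\<And>x. (p x)\<^sup>2 - (q x)\<^sup>2 = 2 * m * of_real (l * deriv u x)"
    and pq: "\<And>x. 2 * p x * q x = m * of_real (l * (c - 4 * l\<^sup>2 - 2 * (u x)\<^sup>2))"
    using assms(1) unfolding periodic_eigenfunction_def by blast
  show thesis
  proof (rule that[of "m * of_real l"])
    show "m * of_real l \<noteq> 0" using m \<open>l \<noteq> 0\<close> by simp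
    fix x
    show "(p x)\<^sup>2 + (q x)\<^sup>2 = 4 * (m * of_real l) * of_real (l * u x - l' * l'')"
      unfolding sum e by (simp add: algebra_simps power2_eq_square)
    show "(p x)\<^sup>2 - (q x)\<^sup>2 = 2 * (m * of_real l) * of_real (deriv u x)"
      unfolding diff by simp
    have "2 * (p x * q x) = 2 * (m * of_real l * of_real (l'\<^sup>2 + l''\<^sup>2 - l\<^sup>2 - (u x)\<^sup>2))"
      using pq[of x] by (simp add: c algebra_simps power2_eq_square)
    then show "p x * q x = m * of_real l * of_real (l'\<^sup>2 + l''\<^sup>2 - l\<^sup>2 - (u x)\<^sup>2)" by simp
  qed
qed

lemma onefold_DT_eigenfunction:
  assumes "periodic_eigenfunction u c e l p q"
    and "c = 2 * (l\<^sup>2 + l'\<^sup>2 + l''\<^sup>2)" "e = - 4 * l * l' * l''" "l \<noteq> 0"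
    and "l * u x - l' * l'' \<noteq> 0"
  shows "onefold_den (p x) (q x) \<noteq> 0"
    and "onefold_DT l p q u x =
      of_real (u x + l * (l'\<^sup>2 + l''\<^sup>2 - l\<^sup>2 - (u x)\<^sup>2) / (l * u x - l' * l''))"
proof -
  obtain M where M: "M \<noteq> 0"
    and den: "(p x)\<^sup>2 + (q x)\<^sup>2 = 4 * M * of_real (l * u x - l' * l'')"
    and num: "p x * q x = M * of_real (l'\<^sup>2 + l''\<^sup>2 - l\<^sup>2 - (u x)\<^sup>2)"
    using periodic_eigenfunction_squares[OF assms(1-4)] by metis
  have "complex_of_real (l * u x - l' * l'') \<noteq> 0"
    using assms(5) by (simp only: of_real_eq_0_iff not_False_eq_True)
  then show "onefold_den (p x) (q x) \<noteq> 0"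
    unfolding onefold_den_def den using M by (simp del: of_real_diff)
  show "onefold_DT l p q u x =
      of_real (u x + l * (l'\<^sup>2 + l''\<^sup>2 - l\<^sup>2 - (u x)\<^sup>2) / (l * u x - l' * l''))"
    using M by (simp add: onefold_DT_def onefold_den_def den num mult.assoc del: of_real_diff of_real_add
        add: of_real_add[of "u x"])
qed

text \<open>The right-hand side is minus the one-fold value for the remaining eigenvalue
  \<open>l''\<close>; this is how the complementary symmetry appears, without the
  reflection.\<close>

lemma twofold_DT_eigenfunctions:
  assumes eig: "periodic_eigenfunction u c e l p q" "periodic_eigenfunction u c e l' p' q'"
    and c: "c = 2 * (l\<^sup>2 + l'\<^sup>2 + l''\<^sup>2)" and e: "e = - 4 * l * l' * l''"
    and nz: "l \<noteq> 0" "l' \<noteq> 0" "l\<^sup>2 \<noteq> l'\<^sup>2" "l'' * u x - l * l' \<noteq> 0"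
    and energy: "(deriv u x)\<^sup>2 = 4 * (l * u x - l' * l'')\<^sup>2 - (l'\<^sup>2 + l''\<^sup>2 - l\<^sup>2 - (u x)\<^sup>2)\<^sup>2"
  shows "twofold_den (of_real l) (p x) (q x) (of_real l') (p' x) (q' x) \<noteq> 0"
    and "twofold_DT l p q l' p' q' u x =
      of_real (- (u x + l'' * (l\<^sup>2 + l'\<^sup>2 - l''\<^sup>2 - (u x)\<^sup>2) / (l'' * u x - l * l')))"
proof -
  let ?r = complex_of_real
  obtain M where M: "M \<noteq> 0"
    and p: "(p x)\<^sup>2 + (q x)\<^sup>2 = 4 * M * ?r (l * u x - l' * l'')"
      "(p x)\<^sup>2 - (q x)\<^sup>2 = 2 * M * ?r (deriv u x)"
      "p x * q x = M * ?r (l'\<^sup>2 + l''\<^sup>2 - l\<^sup>2 - (u x)\<^sup>2)"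
    using periodic_eigenfunction_squares[OF eig(1) c e nz(1)] by metis
  have c': "c = 2 * (l'\<^sup>2 + l\<^sup>2 + l''\<^sup>2)" and e': "e = - 4 * l' * l * l''" using c e by auto
  obtain M' where M': "M' \<noteq> 0"
    and p': "(p' x)\<^sup>2 + (q' x)\<^sup>2 = 4 * M' * ?r (l' * u x - l * l'')"
      "(p' x)\<^sup>2 - (q' x)\<^sup>2 = 2 * M' * ?r (deriv u x)"
      "p' x * q' x = M' * ?r (l\<^sup>2 + l''\<^sup>2 - l'\<^sup>2 - (u x)\<^sup>2)"
    using periodic_eigenfunction_squares[OF eig(2) c' e' nz(2)] by metis
  have energy': "(?r (deriv u x))\<^sup>2 =
      4 * (?r (l * u x - l' * l''))\<^sup>2 - (?r (l'\<^sup>2 + l''\<^sup>2 - l\<^sup>2 - (u x)\<^sup>2))\<^sup>2"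
    unfolding of_real_power[symmetric] energy by simp
  define a g where ag_def: "a = l'' * u x - l * l'" "g = l\<^sup>2 + l'\<^sup>2 - l''\<^sup>2 - (u x)\<^sup>2"
  define K where "K = M * M' * ((?r l)\<^sup>2 - (?r l')\<^sup>2)\<^sup>2"
  have den: "twofold_den (?r l) (p x) (q x) (?r l') (p' x) (q' x)
      = - 16 * K * ?r a"
    unfolding K_def mult.assoc[symmetric] by (rule twofold_den_reduced[OF p p' _ _ _ _ _ energy']) (simp_all add: ag_def)
  have num: "twofold_num (?r l) (p x) (q x) (?r l') (p' x) (q' x)
      = 4 * K * (2 * ?r (u x) * ?r a + ?r l'' * ?r g)"
    unfolding K_def mult.assoc[symmetric] by (rule twofold_num_reduced[OF p(1,3) p'(1,3)]) (simp_all add: ag_def)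
  have "(?r l)\<^sup>2 - (?r l')\<^sup>2 \<noteq> 0"
    using nz(3) by (metis eq_iff_diff_eq_0 of_real_eq_iff of_real_power)
  moreover have a: "?r a \<noteq> 0"
    using nz(4) unfolding ag_def by (simp only: of_real_eq_0_iff not_False_eq_True)
  ultimately have K: "K \<noteq> 0"
    using M M' by (simp add: K_def)
  then show "twofold_den (?r l) (p x) (q x) (?r l') (p' x) (q' x) \<noteq> 0"
    unfolding den using a by simp
  have "twofold_DT l p q l' p' q' u x = ?r (u x) - (2 * ?r (u x) * ?r a + ?r l'' * ?r g) / ?r a"
    unfolding twofold_DT_def den num using K a by (simp add: divide_simps)
  also have "\<dots> = ?r (- (u x + l'' * g / a))"
    using a by (simp add: field_simps)
  finally show "twofold_DT l p q l' p' q' u x =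
      of_real (- (u x + l'' * (l\<^sup>2 + l'\<^sup>2 - l''\<^sup>2 - (u x)\<^sup>2) / (l'' * u x - l * l')))"
    unfolding ag_def .
qed

lemma threefold_DT_eigenfunctions:
  assumes eig: "periodic_eigenfunction u c e l1 p1 q1" "periodic_eigenfunction u c e l2 p2 q2"
      "periodic_eigenfunction u c e l3 p3 q3"
    and c: "c = 2 * (l1\<^sup>2 + l2\<^sup>2 + l3\<^sup>2)" and e: "e = - 4 * l1 * l2 * l3"
    and nz: "l1 \<noteq> 0" "l2 \<noteq> 0" "l3 \<noteq> 0" "l1\<^sup>2 \<noteq> l2\<^sup>2" "l1\<^sup>2 \<noteq> l3\<^sup>2" "l2\<^sup>2 \<noteq> l3\<^sup>2"
    and energy: "(deriv u x)\<^sup>2 = 4 * (l1 * u x - l2 * l3)\<^sup>2 - (l2\<^sup>2 + l3\<^sup>2 - l1\<^sup>2 - (u x)\<^sup>2)\<^sup>2"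
  shows "threefold_den (of_real l1) (p1 x) (q1 x) (of_real l2) (p2 x) (q2 x)
      (of_real l3) (p3 x) (q3 x) \<noteq> 0"
    and "threefold_DT l1 p1 q1 l2 p2 q2 l3 p3 q3 u x = of_real (- u x)"
proof -
  let ?r = complex_of_real
  obtain M1 where M1: "M1 \<noteq> 0"
    and p1: "(p1 x)\<^sup>2 + (q1 x)\<^sup>2 = 4 * M1 * ?r (l1 * u x - l2 * l3)"
      "(p1 x)\<^sup>2 - (q1 x)\<^sup>2 = 2 * M1 * ?r (deriv u x)"
      "p1 x * q1 x = M1 * ?r (l2\<^sup>2 + l3\<^sup>2 - l1\<^sup>2 - (u x)\<^sup>2)"
    using periodic_eigenfunction_squares[OF eig(1) c e nz(1)] by metis
  have c2: "c = 2 * (l2\<^sup>2 + l1\<^sup>2 + l3\<^sup>2)" and e2: "e = - 4 * l2 * l1 * l3" using c e by auto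
  obtain M2 where M2: "M2 \<noteq> 0"
    and p2: "(p2 x)\<^sup>2 + (q2 x)\<^sup>2 = 4 * M2 * ?r (l2 * u x - l1 * l3)"
      "(p2 x)\<^sup>2 - (q2 x)\<^sup>2 = 2 * M2 * ?r (deriv u x)"
      "p2 x * q2 x = M2 * ?r (l1\<^sup>2 + l3\<^sup>2 - l2\<^sup>2 - (u x)\<^sup>2)"
    using periodic_eigenfunction_squares[OF eig(2) c2 e2 nz(2)] by metis
  have c3: "c = 2 * (l3\<^sup>2 + l1\<^sup>2 + l2\<^sup>2)" and e3: "e = - 4 * l3 * l1 * l2" using c e by auto
  obtain M3 where M3: "M3 \<noteq> 0"
    and p3: "(p3 x)\<^sup>2 + (q3 x)\<^sup>2 = 4 * M3 * ?r (l3 * u x - l1 * l2)"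
      "(p3 x)\<^sup>2 - (q3 x)\<^sup>2 = 2 * M3 * ?r (deriv u x)"
      "p3 x * q3 x = M3 * ?r (l1\<^sup>2 + l2\<^sup>2 - l3\<^sup>2 - (u x)\<^sup>2)"
    using periodic_eigenfunction_squares[OF eig(3) c3 e3 nz(3)] by metis
  have energy': "(?r (deriv u x))\<^sup>2 =
      4 * (?r (l1 * u x - l2 * l3))\<^sup>2 - (?r (l2\<^sup>2 + l3\<^sup>2 - l1\<^sup>2 - (u x)\<^sup>2))\<^sup>2"
    unfolding of_real_power[symmetric] energy by simp
  define V where "V = (((?r l1)\<^sup>2 - (?r l2)\<^sup>2) * ((?r l1)\<^sup>2 - (?r l3)\<^sup>2) * ((?r l2)\<^sup>2 - (?r l3)\<^sup>2))\<^sup>2"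
  have den: "threefold_den (?r l1) (p1 x) (q1 x) (?r l2) (p2 x) (q2 x) (?r l3) (p3 x) (q3 x)
      = - 64 * M1 * M2 * M3 * V"
    unfolding V_def by (rule threefold_den_reduced[OF p1 p2 p3 _ _ _ _ _ _ energy']) simp_all
  have num: "threefold_num (?r l1) (p1 x) (q1 x) (?r l2) (p2 x) (q2 x) (?r l3) (p3 x) (q3 x)
      = 32 * M1 * M2 * M3 * V * ?r (u x)"
    unfolding V_def by (rule threefold_num_reduced[OF p1 p2 p3 _ _ _ _ _ _ energy']) simp_all
  have "?r l ^ 2 - ?r l' ^ 2 \<noteq> 0" if "l\<^sup>2 \<noteq> l'\<^sup>2" for l l'
    using that by (metis eq_iff_diff_eq_0 of_real_eq_iff of_real_power)
  then have V: "V \<noteq> 0" using nz(4-6) by (simp add: V_def)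
  then show "threefold_den (?r l1) (p1 x) (q1 x) (?r l2) (p2 x) (q2 x) (?r l3) (p3 x) (q3 x) \<noteq> 0"
    unfolding den using M1 M2 M3 by simp
  show "threefold_DT l1 p1 q1 l2 p2 q2 l3 p3 q3 u x = of_real (- u x)"
    unfolding threefold_DT_def den num using V M1 M2 M3 by (simp add: field_simps)
qed


section \<open>The parameter exchanges as Moebius involutions of the wave\<close>

text \<open>The map from u to (l' l'' u - l (l'^2 + l''^2 - l^2)) / (l u - l' l'') exchanges the
  parameters in the pairs prescribed by the symmetry belonging to l. The pole l' l'' / l lies
  outside the range of the wave, which gives the nonvanishing claims.\<close>

lemma periodic_wave_symmetries:
  fixes l1 l2 l3 nu k x :: real
  assumes l: "l2 < l1" "l3 < l2" "0 < l2 + l3" "l3 \<noteq> 0"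
  defines "us \<equiv> (l1 + l2 - l3, l1 - l2 + l3, - l1 + l2 + l3, - l1 - l2 - l3)"
  defines "u \<equiv> periodic_wave nu k us x"
  shows "l1 * u - l2 * l3 \<noteq> 0" "l2 * u - l1 * l3 \<noteq> 0" "l3 * u - l1 * l2 \<noteq> 0"
    and "u + l1 * (l2\<^sup>2 + l3\<^sup>2 - l1\<^sup>2 - u\<^sup>2) / (l1 * u - l2 * l3) = - periodic_wave nu k (symmetry 1 us) x"
    and "u + l2 * (l1\<^sup>2 + l3\<^sup>2 - l2\<^sup>2 - u\<^sup>2) / (l2 * u - l1 * l3) = - periodic_wave nu k (symmetry 2 us) x"
    and "u + l3 * (l1\<^sup>2 + l2\<^sup>2 - l3\<^sup>2 - u\<^sup>2) / (l3 * u - l1 * l2) = - periodic_wave nu k (symmetry 3 us) x"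
proof -
  have pos: "0 < l1" "0 < l2" "0 < l1 + l3" "l3 < l1" using l by linarith+
  have b: "l1 - l2 + l3 \<le> u" "u \<le> l1 + l2 - l3"
    unfolding u_def us_def by (rule periodic_wave_bounds; use l pos in simp)+
  have "l1 * (l1 - l2 + l3) \<le> l1 * u" using b pos by simp
  moreover have "l1 * (l1 - l2 + l3) - l2 * l3 = (l1 - l2) * (l1 + l3)" by algebra
  moreover have "0 < (l1 - l2) * (l1 + l3)" using l pos by simp
  ultimately show a1: "l1 * u - l2 * l3 \<noteq> 0" by linarith
  have "l2 * (l1 - l2 + l3) \<le> l2 * u" using b pos by simp
  moreover have "l2 * (l1 - l2 + l3) - l1 * l3 = (l1 - l2) * (l2 - l3)" by algebra
  moreover have "0 < (l1 - l2) * (l2 - l3)" using l pos by simp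
  ultimately show a2: "l2 * u - l1 * l3 \<noteq> 0" by linarith
  \<comment> \<open>Only \<open>l3\<close> has undetermined sign. The expression is negative in both
    cases, its maximum being at the upper end of the range of u if \<open>l3\<close> is positive and
    at the lower end if it is negative.\<close>
  show a3: "l3 * u - l1 * l2 \<noteq> 0"
  proof (cases "0 < l3")
    case True
    then have "l3 * u \<le> l3 * (l1 + l2 - l3)" using b by simp
    moreover have "l3 * (l1 + l2 - l3) - l1 * l2 = - ((l1 - l3) * (l2 - l3))" by algebra
    moreover have "0 < (l1 - l3) * (l2 - l3)" using l pos by simp
    ultimately show ?thesis by linarith
  next
    case False
    then have "l3 * u \<le> l3 * (l1 - l2 + l3)" using b by (simp add: mult_left_mono_neg)
    moreover have "l3 * (l1 - l2 + l3) - l1 * l2 = - ((l1 + l3) * (l2 - l3))" by algebra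
    moreover have "0 < (l1 + l3) * (l2 - l3)" using l pos by simp
    ultimately show ?thesis by linarith
  qed
  \<comment> \<open>Both u and W are fractions in y. Multiplying by their denominators D and D'
    turns the claim into a polynomial consequence of the cleared equations for the two
    waves.\<close>
  have moebius: "u + l * (l'\<^sup>2 + l''\<^sup>2 - l\<^sup>2 - u\<^sup>2) / (l * u - l' * l'') = - W"
    if "D \<noteq> 0" "D' \<noteq> 0" "l * u - l' * l'' \<noteq> 0"
      "D * D' * (W * (l * u - l' * l'') - (l' * l'' * u - l * (l'\<^sup>2 + l''\<^sup>2 - l\<^sup>2))) = 0"
    for l l' l'' D D' W
  proof -
    have "W * (l * u - l' * l'') = l' * l'' * u - l * (l'\<^sup>2 + l''\<^sup>2 - l\<^sup>2)" using that by simp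
    then have "W = (l' * l'' * u - l * (l'\<^sup>2 + l''\<^sup>2 - l\<^sup>2)) / (l * u - l' * l'')"
      using that(3) by (simp add: eq_divide_eq)
    then show ?thesis using that(3) by (simp add: divide_simps) (simp add: algebra_simps power2_eq_square)
  qed
  define y where "y = (jacobi_sn k (nu * x))\<^sup>2"
  have y: "0 \<le> y" "y \<le> 1" by (simp_all add: y_def jacobi_sn_sq_le_1)
  have same_sign: "0 < (l1 + l2 - l3 - (- l1 - l2 - l3)) * (l1 - l2 + l3 - (- l1 - l2 - l3))"
    "0 < (l1 - l2 + l3 - (- l1 + l2 + l3)) * (l1 + l2 - l3 - (- l1 + l2 + l3))"
    "0 < (- l1 + l2 + l3 - (l1 - l2 + l3)) * (- l1 - l2 - l3 - (l1 - l2 + l3))"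
    "0 < (- l1 - l2 - l3 - (l1 + l2 - l3)) * (- l1 + l2 + l3 - (l1 + l2 - l3))"
    using l pos by (auto intro!: mult_pos_pos mult_neg_neg)
  note nz = same_sign[THEN periodic_wave_denominator_nonzero, OF y]
  note eq = same_sign[THEN periodic_wave_times_denominator, of nu k _ x, folded y_def]
  note uD = eq(1)[of "- l1 + l2 + l3", folded us_def, folded u_def]
  show "u + l1 * (l2\<^sup>2 + l3\<^sup>2 - l1\<^sup>2 - u\<^sup>2) / (l1 * u - l2 * l3) = - periodic_wave nu k (symmetry 1 us) x"
    by (rule moebius[OF nz(1,2) a1], insert uD eq(2)[of "- l1 - l2 - l3"],
        simp add: symmetry_def us_def) algebra
  show "u + l2 * (l1\<^sup>2 + l3\<^sup>2 - l2\<^sup>2 - u\<^sup>2) / (l2 * u - l1 * l3) = - periodic_wave nu k (symmetry 2 us) x"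
    by (rule moebius[OF nz(1,3) a2], insert uD eq(3)[of "l1 + l2 - l3"],
        simp add: symmetry_def us_def) algebra
  show "u + l3 * (l1\<^sup>2 + l2\<^sup>2 - l3\<^sup>2 - u\<^sup>2) / (l3 * u - l1 * l2) = - periodic_wave nu k (symmetry 3 us) x"
    by (rule moebius[OF nz(1,4) a3], insert uD eq(4)[of "l1 - l2 + l3"],
        simp add: symmetry_def us_def) algebra
qed


section \<open>Combining eigenvalues, symmetries and periods\<close>

theorem theorem3:
  fixes u1 u2 u3 u4 nu kappa c e :: real
    and lam :: "nat \<Rightarrow> real"
    and u :: "real \<Rightarrow> real"
  assumes order: "u4 < u3" "u3 < u2" "u2 < u1"
    and sum_zero: "u1 + u2 + u3 + u4 = 0"
    and nonzero: "u1 + u2 \<noteq> 0" "u1 + u3 \<noteq> 0" "u2 + u3 \<noteq> 0"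
    and nu: "0 < nu" "4 * nu\<^sup>2 = (u1 - u3) * (u2 - u4)"
    and kappa: "0 < kappa" "kappa < 1" "4 * nu\<^sup>2 * kappa\<^sup>2 = (u1 - u2) * (u3 - u4)"
    and u: "u = periodic_wave nu kappa (u1, u2, u3, u4)"
    and c: "c = - (u1 * u2 + u1 * u3 + u1 * u4 + u2 * u3 + u2 * u4 + u3 * u4)"
    and e: "2 * e = u1 * u2 * u3 + u1 * u2 * u4 + u1 * u3 * u4 + u2 * u3 * u4"
    and lam: "lam 1 = (u1 + u2) / 2" "lam 2 = (u1 + u3) / 2" "lam 3 = (u2 + u3) / 2"
  shows
    "(\<forall>j\<in>{1, 2, 3}. \<exists>p q. periodic_eigenfunction u c e (lam j) p q) \<and>
     (\<exists>T. fundamental_period u T \<and>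
       (\<forall>j\<in>{1, 2, 3}. \<forall>p q.
          periodic_eigenfunction u c e (lam j) p q \<longrightarrow>
            (\<forall>x. onefold_den (p x) (q x) \<noteq> 0) \<and>
            (\<forall>x. onefold_DT (lam j) p q u x =
               of_real (- periodic_wave nu kappa (symmetry j (u1, u2, u3, u4)) x)) \<and>
            fundamental_period (onefold_DT (lam j) p q u) T) \<and>
       (\<forall>i j k. {i, j, k} = {1, 2, 3} \<and> i \<noteq> j \<and> i \<noteq> k \<and> j \<noteq> k \<longrightarrow>
          (\<forall>p q p' q'.
             periodic_eigenfunction u c e (lam i) p q \<and>
             periodic_eigenfunction u c e (lam j) p' q' \<longrightarrow>
               (\<forall>x. twofold_den (of_real (lam i)) (p x) (q x)
                      (of_real (lam j)) (p' x) (q' x) \<noteq> 0) \<and>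
               (\<forall>x. twofold_DT (lam i) p q (lam j) p' q' u x =
                  of_real (periodic_wave nu kappa (symmetry k (u1, u2, u3, u4)) x)) \<and>
               fundamental_period (twofold_DT (lam i) p q (lam j) p' q' u) T)) \<and>
       (\<forall>p1 q1 p2 q2 p3 q3.
          periodic_eigenfunction u c e (lam 1) p1 q1 \<and>
          periodic_eigenfunction u c e (lam 2) p2 q2 \<and>
          periodic_eigenfunction u c e (lam 3) p3 q3 \<longrightarrow>
            (\<forall>x. threefold_den (of_real (lam 1)) (p1 x) (q1 x) (of_real (lam 2)) (p2 x) (q2 x)
                   (of_real (lam 3)) (p3 x) (q3 x) \<noteq> 0) \<and>
            (\<forall>x. threefold_DT (lam 1) p1 q1 (lam 2) p2 q2 (lam 3) p3 q3 u x =
               of_real (- u x))))"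
proof -
  define l1 l2 l3 where l_def: "l1 = (u1 + u2) / 2" "l2 = (u1 + u3) / 2" "l3 = (u2 + u3) / 2"
  have lam': "lam 1 = l1" "lam 2 = l2" "lam 3 = l3" "lam (Suc 0) = l1"
    using lam by (simp_all add: l_def)
  have us: "u1 = l1 + l2 - l3" "u2 = l1 - l2 + l3" "u3 = - l1 + l2 + l3" "u4 = - l1 - l2 - l3"
    using sum_zero by (simp_all add: l_def field_simps)
  have l: "l2 < l1" "l3 < l2" "0 < l2 + l3" "l3 \<noteq> 0"
    using order sum_zero nonzero by (simp_all add: l_def field_simps)
  have pos: "0 < l1" "0 < l2" "0 < l1 + l3" "l3 < l1" using l by linarith+
  have c': "c = 2 * (l1\<^sup>2 + l2\<^sup>2 + l3\<^sup>2)"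
    unfolding c us by algebra
  have e': "e = - 4 * l1 * l2 * l3"
  proof -
    have "2 * e = 2 * (- 4 * l1 * l2 * l3)" unfolding e us by algebra
    then show ?thesis by simp
  qed
  have "u4 < u2" using order by simp
  then obtain v where v: "\<And>x. DERIV u x :> v x"
    and v': "\<And>x. DERIV v x :> - 2 * (u x) ^ 3 + c * u x + e"
    and v2: "\<And>x. (v x)\<^sup>2 = - ((u x - u1) * (u x - u2) * (u x - u3) * (u x - u4))"
    using periodic_wave_derivs[OF _ order(3) sum_zero nu(2) kappa c e] unfolding u by blast
  have dv: "deriv u x = v x" for x using v by (rule DERIV_imp_deriv)
  define W where "W i = periodic_wave nu kappa (symmetry i (u1, u2, u3, u4))" for i
  \<comment> \<open>The facts below are proved for all six arrangements, so that any eigenvalue can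
    be singled out and the other two taken in either order.\<close>
  define perm where "perm i j k \<longleftrightarrow> {i, j, k} = {1, 2, 3} \<and> i \<noteq> j \<and> i \<noteq> k \<and> j \<noteq> k" for i j k :: nat
  have permD: "(i, j, k) \<in> {(1, 2, 3), (1, 3, 2), (2, 1, 3), (2, 3, 1), (3, 1, 2), (3, 2, 1)}"
    if "perm i j k" for i j k
  proof -
    have "i \<in> {1, 2, 3}" "j \<in> {1, 2, 3}" "k \<in> {1, 2, 3}" using that unfolding perm_def by blast+
    then show ?thesis using that by (auto simp: perm_def)
  qed
  note sym = periodic_wave_symmetries[OF l, of nu kappa, folded us, folded u]
  have lam_nz: "lam i \<noteq> 0" if "perm i j k" for i j k
    using permD[OF that] l pos by (auto simp: lam')
  have lam_sq: "(lam i)\<^sup>2 \<noteq> (lam j)\<^sup>2" if "perm i j k" for i j k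
    using permD[OF that] l pos by (auto simp: lam' power2_eq_iff)
  have cp: "c = 2 * ((lam i)\<^sup>2 + (lam j)\<^sup>2 + (lam k)\<^sup>2)" if "perm i j k" for i j k
    using permD[OF that] by (auto simp: lam' c')
  have ep: "e = - 4 * lam i * lam j * lam k" if "perm i j k" for i j k
    using permD[OF that] by (auto simp: lam' e')
  have anz: "lam i * u x - lam j * lam k \<noteq> 0" if "perm i j k" for i j k x
    using permD[OF that] sym(1-3)[of x] by (auto simp: lam' mult.commute)
  have wave: "u x + lam i * ((lam j)\<^sup>2 + (lam k)\<^sup>2 - (lam i)\<^sup>2 - (u x)\<^sup>2) / (lam i * u x - lam j * lam k)
      = - W i x" if "perm i j k" for i j k x
    using permD[OF that] sym(4-6)[of x]
    by (auto simp: lam' W_def mult.commute add.commute)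
  have energy: "(deriv u x)\<^sup>2 = 4 * (lam i * u x - lam j * lam k)\<^sup>2
      - ((lam j)\<^sup>2 + (lam k)\<^sup>2 - (lam i)\<^sup>2 - (u x)\<^sup>2)\<^sup>2" if "perm i j k" for i j k x
  proof -
    \<comment> \<open>A difference of squares twice over: 2a + g = (l' - l'')^2 - (t - l)^2 and 2a -
      g = (t + l)^2 - (l' + l'')^2.\<close>
    have quartic: "4 * (l * t - l' * l'')\<^sup>2 - (l'\<^sup>2 + l''\<^sup>2 - l\<^sup>2 - t\<^sup>2)\<^sup>2
      = - ((t - (l + l' - l'')) * (t - (l - l' + l'')) * (t - (- l + l' + l'')) * (t - (- l - l' - l'')))"
      for l l' l'' t :: real by algebra
    show ?thesis
      using permD[OF that] unfolding quartic dv v2 us by (auto simp: lam' algebra_simps)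
  qed
  have ex_perm: "\<exists>j k. perm i j k" if "i \<in> {1, 2, 3}" for i
  proof -
    have "perm 1 2 3" "perm 2 1 3" "perm 3 1 2" by (auto simp: perm_def)
    then show ?thesis using that by blast
  qed
  define T where "T = elliptic_F kappa pi / nu"
  have y: "fundamental_period (\<lambda>x. (jacobi_sn kappa (nu * x))\<^sup>2) T"
    unfolding T_def by (rule fundamental_period_jacobi_sn_sq[OF kappa(1,2) nu(1)])
  have u_eq: "u x = u x' \<longleftrightarrow> (jacobi_sn kappa (nu * x))\<^sup>2 = (jacobi_sn kappa (nu * x'))\<^sup>2" for x x'
    unfolding u by (rule periodic_wave_eq_iff) (use order in \<open>auto intro!: mult_pos_pos\<close>)
  have W_eq: "W i x = W i x' \<longleftrightarrow> (jacobi_sn kappa (nu * x))\<^sup>2 = (jacobi_sn kappa (nu * x'))\<^sup>2"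
    if "i \<in> {1, 2, 3}" for i x x'
  proof -
    have "W 1 x = W 1 x' \<longleftrightarrow> (jacobi_sn kappa (nu * x))\<^sup>2 = (jacobi_sn kappa (nu * x'))\<^sup>2"
      unfolding W_def symmetry_def
      by simp (rule periodic_wave_eq_iff; use order in \<open>auto intro!: mult_pos_pos\<close>)
    moreover have "W 2 x = W 2 x' \<longleftrightarrow> (jacobi_sn kappa (nu * x))\<^sup>2 = (jacobi_sn kappa (nu * x'))\<^sup>2"
      unfolding W_def symmetry_def
      by simp (rule periodic_wave_eq_iff; use order in \<open>auto intro!: mult_neg_neg\<close>)
    moreover have "W 3 x = W 3 x' \<longleftrightarrow> (jacobi_sn kappa (nu * x))\<^sup>2 = (jacobi_sn kappa (nu * x'))\<^sup>2"
      unfolding W_def symmetry_def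
      by simp (rule periodic_wave_eq_iff; use order in \<open>auto intro!: mult_neg_neg\<close>)
    ultimately show ?thesis using that by auto
  qed
  have per_u: "fundamental_period u T"
    using y fundamental_period_cong[OF u_eq] by simp
  have per_W: "fundamental_period f T"
    \<comment> \<open>The two alternatives serve the two-fold and the one-fold transformation
      respectively.\<close>
    if "i \<in> {1, 2, 3}" "(\<forall>x. f x = complex_of_real (W i x)) \<or> (\<forall>x. f x = complex_of_real (- W i x))" for i f
  proof -
    have "f x = f x' \<longleftrightarrow> (jacobi_sn kappa (nu * x))\<^sup>2 = (jacobi_sn kappa (nu * x'))\<^sup>2" for x x'
      using that(2) W_eq[OF that(1), of x x'] by (metis neg_equal_iff_equal of_real_eq_iff)
    from fundamental_period_cong[of f, OF this] y show ?thesis by simp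
  qed
  have one: "\<exists>p q. periodic_eigenfunction u c e (lam i) p q" if "i \<in> {1, 2, 3}" for i
  proof -
    obtain j k where P: "perm i j k" using ex_perm[OF \<open>i \<in> _\<close>] by blast
    have A: "e + 4 * (lam i)\<^sup>2 * u x = 4 * lam i * (lam i * u x - lam j * lam k)" for x
      unfolding ep[OF P] by algebra
    \<comment> \<open>This is the first integral 4 a^2 = u'^2 + g^2 multiplied by
      \<open>4 * (lam i)\<^sup>2\<close>.\<close>
    have "(e + 4 * (lam i)\<^sup>2 * u x)\<^sup>2 = (2 * lam i * v x)\<^sup>2
        + (lam i * (c - 4 * (lam i)\<^sup>2 - 2 * (u x)\<^sup>2))\<^sup>2" for x
      unfolding A cp[OF P] dv[symmetric] power_mult_distrib[of "2 * lam i"] energy[OF P] by algebra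
    moreover have "e + 4 * (lam i)\<^sup>2 * u x \<noteq> 0" for x
      unfolding A using lam_nz[OF P] anz[OF P, of x] by simp
    ultimately show ?thesis by (rule periodic_eigenfunction_exists[OF v v'])
  qed
  have onefold: "(\<forall>x. onefold_den (p x) (q x) \<noteq> 0) \<and>
      (\<forall>x. onefold_DT (lam i) p q u x = of_real (- W i x)) \<and>
      fundamental_period (onefold_DT (lam i) p q u) T"
    if i: "i \<in> {1, 2, 3}" and eig: "periodic_eigenfunction u c e (lam i) p q" for i p q
  proof -
    obtain j k where P: "perm i j k" using ex_perm[OF i] by blast
    note D = onefold_DT_eigenfunction[OF eig cp[OF P] ep[OF P] lam_nz[OF P] anz[OF P]]
    have "onefold_DT (lam i) p q u x = of_real (- W i x)" for x
      using D(2)[of x] unfolding wave[OF P] .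
    then show ?thesis using D(1) per_W[OF i] by blast
  qed
  have twofold: "(\<forall>x. twofold_den (of_real (lam i)) (p x) (q x) (of_real (lam j)) (p' x) (q' x) \<noteq> 0) \<and>
      (\<forall>x. twofold_DT (lam i) p q (lam j) p' q' u x = of_real (W k x)) \<and>
      fundamental_period (twofold_DT (lam i) p q (lam j) p' q' u) T"
    if P: "perm i j k" and eig: "periodic_eigenfunction u c e (lam i) p q"
      "periodic_eigenfunction u c e (lam j) p' q'" for i j k p q p' q'
  proof -
    have P': "perm j i k" "perm k i j" and k: "k \<in> {1, 2, 3}"
      using permD[OF P] by (auto simp: perm_def)
    note D = twofold_DT_eigenfunctions[OF eig cp[OF P] ep[OF P] lam_nz[OF P] lam_nz[OF P'(1)]
        lam_sq[OF P] anz[OF P'(2)] energy[OF P]]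
    \<comment> \<open>The two-fold value is minus the one-fold value for \<open>lam k\<close>, which
      is itself \<open>- W k x\<close>; the signs cancel.\<close>
    have "twofold_DT (lam i) p q (lam j) p' q' u x = of_real (W k x)" for x
      using D(2)[of x] unfolding wave[OF P'(2)] by simp
    then show ?thesis using D(1) per_W[OF k] by blast
  qed
  have P: "perm 1 2 3" "perm 2 1 3" "perm 3 1 2" "perm 1 3 2" "perm 2 3 1" by (auto simp: perm_def)
  note threefold = threefold_DT_eigenfunctions[OF _ _ _ cp[OF P(1)] ep[OF P(1)] P(1-3)[THEN lam_nz]
      lam_sq[OF P(1)] lam_sq[OF P(4)] lam_sq[OF P(5)] energy[OF P(1)]]
  show ?thesis
  proof (intro conjI exI[of _ T], goal_cases)
    case 1
    show ?case by (intro ballI one)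
  next
    case 2
    show ?case by (rule per_u)
  next
    case 3
    show ?case by (intro ballI allI impI, rule onefold[unfolded W_def])
  next
    case 4
    show ?case
    proof (intro allI impI, elim conjE, goal_cases)
      case (1 i j k p q p' q')
      then have "perm i j k" by (simp only: perm_def simp_thms)
      from twofold[OF this 1(2,3)] show ?case unfolding W_def .
    qed
  next
    case 5
    show ?case
    proof (intro allI impI, elim conjE, goal_cases)
      case 1
      show ?case by (intro conjI allI; rule threefold[OF 1])
    qed
  qed
qed

end
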